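(* (Poisson) Let $E$ be a $T$-universally complete Riesz space with weak order unit $e=Te$, where $T$ is a strictly positive conditional expectation operator on $E$. Let $P_{n,k}$, $k=1,\dots,n$, $n\in\mathbb{N}$, be $T$-conditionally independent band projections on $E$ with $TP_{n,k}e=g_n$ for all $k=1,\dots,n$, $n\in\mathbb{N}$ (for some $g_n\in E$). If the elements $S_n=\sum_{k=1}^nP_{n,k}e$, $n\in\mathbb{N}$, are $T$-conditionally independent with $TS_n=g$ for all $n\in\mathbb{N}$ (for some fixed $g\in E$), then for each $j=0,1,\dots$, $$TP_{S_n=je}e\to\frac{g^j}{j!}e^{-g}$$ $e$-uniformly as $n\to\infty$.
   Context: A conditional expectation operator on a Dedekind complete Riesz space $E$ with weak order unit is a positive order continuous projection $T:E\to E$ whose range $\mathcal{R}(T)$ is a Dedekind complete Riesz subspace of $E$ and such that $Te$ is a weak order unit of $E$ for each weak order unit $e$ of $E$. $T$ is strictly positive if $f\ge 0$ and $Tf=0$ imply $f=0$. Given a strictly positive conditional expectation operator $T$ on a Dedekind complete Riesz space $E$ with weak order unit, $E$ is called $T$-universally complete if each increasing net $(f_\alpha)$ in $E_+$ for which $(Tf_\alpha)$ is order bounded in the universal completion $E^u$ of $E$ is order convergent in $E$. (A $T$-universally complete space is in particular Dedekind complete.) The universal completion $E^u$ carries its natural $f$-algebra multiplication with multiplicative unit $e$, determined by $(Pe)\cdot(Qe)=PQe$ for band projections $P,Q$. All products and powers are taken in $E^u$, with $h^0=e$. $E^e$ denotes the order ideal of $E$ generated by $e$; it is an $f$-subalgebra.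 For $g\in E^e$, $e^{-g}\in E^e$ is the element obtained by applying the function $t\mapsto e^{-t}$ to $g$ by the continuous functional calculus on $E^e$ (with the constant function $1$ corresponding to the unit $e$); it is the $e$-uniform limit of $\left(e-\frac{g}{n}\right)^n$ as $n\to\infty$. (The hypotheses of the claim give $0\le g\le e$, so $g\in E^e$.) A sequence $(h_n)$ in $E$ converges $e$-uniformly to $h$ if for every real $\epsilon>0$ there is $N$ such that $|h_n-h|\le\epsilon e$ for all $n\ge N$. For $h\in E_+$, $P_h$ denotes the band projection of $E$ onto the band generated by $h$; $P_{S_n=je}:=(I-P_{(S_n-je)^+})(I-P_{(S_n-je)^-})$ is the band projection onto the band where $S_n=je$ ($I$ is the identity map). $T$-conditional independence: Band projections $P,Q$ on $E$ are $T$-conditionally independent if $TPTQe=TPQe=TQTPe$. Riesz subspaces $E_1,E_2$ of $E$ are $T$-conditionally independent if all band projections $P_1,P_2$ in $E$ with $P_1e\in E_1$, $P_2e\in E_2$ are $T$-conditionally independent. For $A\subset E$, $\langle A\rangle$ denotes the order closed Riesz subspace of $E$ generated by $A$. A family $(E_\lambda)_{\lambda\in\Lambda}$ of closed Dedekind complete Riesz subspaces of $E$, each containing $\mathcal{R}(T)$, is $T$-conditionally independent if for each pair of disjoint sets $\Lambda_1,\Lambda_2\subset\Lambda$ the subspaces $\left\langle\bigcup_{\lambda\in\Lambda_1}E_\lambda\right\rangle$ and $\left\langle\bigcup_{\lambda\in\Lambda_2}E_\lambda\right\rangle$ are $T$-conditionally independent. A family $(f_\lambda)$ of elements of $E$ is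 $T$-conditionally independent if the family of subspaces $\langle\{f_\lambda\}\cup\mathcal{R}(T)\rangle$ is $T$-conditionally independent; a family $(P_\lambda)$ of band projections is $T$-conditionally independent if the family of elements $(P_\lambda e)$ is. *)

theory Defs
  imports Complex_Main "HOL-Library.Lattice_Algebras"
begin

section \<open>Riesz spaces and \<open>f\<close>-algebras\<close>

class riesz_space = ordered_real_vector + lattice_ab_group_add_abs

text \<open>The unit is not required to differ from \<open>0\<close>, so that the zero space is covered;
  this is why the class is not based on \<^class>\<open>real_algebra_1\<close>.\<close>

class f_algebra = riesz_space + real_algebra + monoid_mult +
  assumes f_algebra_mult_nonneg: "0 \<le> a \<Longrightarrow> 0 \<le> b \<Longrightarrow> 0 \<le> a * b"
    and f_algebra_disjoint_right: "inf a b = 0 \<Longrightarrow> 0 \<le> c \<Longrightarrow> inf (a * c) b = 0"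
    and f_algebra_disjoint_left: "inf a b = 0 \<Longrightarrow> 0 \<le> c \<Longrightarrow> inf (c * a) b = 0"

text \<open>Dedekind completeness of a subset \<open>R\<close> with respect to the order of \<open>R\<close> itself
  (suprema are taken in \<open>R\<close>).\<close>

definition dedekind_complete :: "'a::riesz_space set \<Rightarrow> bool" where
  "dedekind_complete R \<longleftrightarrow>
    (\<forall>A\<subseteq>R. A \<noteq> {} \<and> (\<exists>u\<in>R. \<forall>a\<in>A. a \<le> u) \<longrightarrow>
      (\<exists>s\<in>R. (\<forall>a\<in>A. a \<le> s) \<and> (\<forall>u\<in>R. (\<forall>a\<in>A. a \<le> u) \<longrightarrow> s \<le> u)))"

definition riesz_subspace :: "'a::riesz_space set \<Rightarrow> bool" where
  "riesz_subspace F \<longleftrightarrow> subspace F \<and> (\<forall>x\<in>F. \<forall>y\<in>F. sup x y \<in> F \<and> inf x y \<in> F)"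

definition order_ideal :: "'a::riesz_space set \<Rightarrow> bool" where
  "order_ideal I \<longleftrightarrow> subspace I \<and> (\<forall>x. \<forall>y\<in>I. \<bar>x\<bar> \<le> \<bar>y\<bar> \<longrightarrow> x \<in> I)"

definition directed_up :: "'a::order set \<Rightarrow> bool" where
  "directed_up D \<longleftrightarrow> D \<noteq> {} \<and> (\<forall>x\<in>D. \<forall>y\<in>D. \<exists>z\<in>D. x \<le> z \<and> y \<le> z)"

definition directed_down :: "'a::order set \<Rightarrow> bool" where
  "directed_down D \<longleftrightarrow> D \<noteq> {} \<and> (\<forall>x\<in>D. \<forall>y\<in>D. \<exists>z\<in>D. z \<le> x \<and> z \<le> y)"

section \<open>Order convergence\<close>

text \<open>Order convergence of a net depends only on its tails, i.e. on the image in the space of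
  the section filter of the index set, and every proper filter arises from a net in this way.
  Quantifying over filters on the space therefore expresses quantification over nets with
  arbitrary index sets.  A net decreasing to \<open>0\<close> is given by its range \<open>Y\<close>, a downward directed
  set with infimum \<open>0\<close>.\<close>

definition order_conv :: "'a::riesz_space filter \<Rightarrow> 'a \<Rightarrow> bool" where
  "order_conv F l \<longleftrightarrow>
    (\<exists>Y. directed_down Y \<and> (\<forall>y\<in>Y. 0 \<le> y) \<and> (\<forall>z. (\<forall>y\<in>Y. z \<le> y) \<longrightarrow> z \<le> 0) \<and>
         (\<forall>y\<in>Y. eventually (\<lambda>x. \<bar>x - l\<bar> \<le> y) F))"

definition order_closed :: "'a::riesz_space set \<Rightarrow> bool" where
  "order_closed C \<longleftrightarrow>
    (\<forall>F l. F \<noteq> bot \<and> eventually (\<lambda>x. x \<in> C) F \<and> order_conv F l \<longrightarrow> l \<in> C)"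

definition order_continuous :: "('a::riesz_space \<Rightarrow> 'b::riesz_space) \<Rightarrow> bool" where
  "order_continuous T \<longleftrightarrow> (\<forall>F l. order_conv F l \<longrightarrow> order_conv (filtermap T F) (T l))"

text \<open>The filter of an upward directed set viewed as an increasing net indexed by itself.\<close>

definition increasing_net :: "'a::order set \<Rightarrow> 'a filter" where
  "increasing_net D = (INF d\<in>D. principal {x \<in> D. d \<le> x})"

definition closed_subspace_gen :: "'a::riesz_space set \<Rightarrow> 'a set" where
  "closed_subspace_gen A = (\<lambda>F. riesz_subspace F \<and> order_closed F) hull A"

definition e_uniform_conv :: "'a::riesz_space \<Rightarrow> (nat \<Rightarrow> 'a) \<Rightarrow> 'a \<Rightarrow> bool" where
  "e_uniform_conv e h l \<longleftrightarrow> (\<forall>\<epsilon>>0::real. \<exists>N. \<forall>n\<ge>N. \<bar>h n - l\<bar> \<le> \<epsilon> *\<^sub>R e)"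

section \<open>Bands and band projections\<close>

definition band :: "'a::riesz_space set \<Rightarrow> bool" where
  "band B \<longleftrightarrow> order_ideal B \<and> order_closed B"

definition band_gen :: "'a::riesz_space \<Rightarrow> 'a set" where
  "band_gen h = band hull {h}"

definition disjoint_compl :: "'a::riesz_space set \<Rightarrow> 'a set" where
  "disjoint_compl B = {x. \<forall>b\<in>B. inf \<bar>x\<bar> \<bar>b\<bar> = 0}"

definition weak_order_unit :: "'a::riesz_space \<Rightarrow> bool" where
  "weak_order_unit e \<longleftrightarrow> 0 \<le> e \<and> band_gen e = UNIV"

definition band_projection :: "('a::riesz_space \<Rightarrow> 'a) \<Rightarrow> bool" where
  "band_projection P \<longleftrightarrow>
    (\<exists>B. band B \<and> (\<forall>x. P x \<in> B \<and> x - P x \<in> disjoint_compl B))"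

text \<open>\<open>band_proj h\<close> is \<open>P\<^sub>h\<close>.  In a Dedekind complete space every band is a projection band, so the
  description below is proper.\<close>

definition band_proj :: "'a::riesz_space \<Rightarrow> 'a \<Rightarrow> 'a" where
  "band_proj h x = (THE y. y \<in> band_gen h \<and> x - y \<in> disjoint_compl (band_gen h))"

text \<open>\<open>proj_eq s t\<close> is \<open>P\<close> with subscript \<open>s = t\<close>, that is
  \<open>(I - P\<^bsub>(s-t)\<^sup>+\<^esub>)(I - P\<^bsub>(s-t)\<^sup>-\<^esub>)\<close>.\<close>

definition proj_eq :: "'a::riesz_space \<Rightarrow> 'a \<Rightarrow> 'a \<Rightarrow> 'a" where
  "proj_eq s t = (\<lambda>x. x - band_proj (sup (s - t) 0) x) \<circ> (\<lambda>x. x - band_proj (sup (- (s - t)) 0) x)"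

section \<open>Universal completion\<close>

definition laterally_complete :: "'u::riesz_space itself \<Rightarrow> bool" where
  "laterally_complete _ \<longleftrightarrow>
    (\<forall>D::'u set. D \<noteq> {} \<and> (\<forall>x\<in>D. 0 \<le> x) \<and> (\<forall>x\<in>D. \<forall>y\<in>D. x \<noteq> y \<longrightarrow> inf x y = 0) \<longrightarrow>
      (\<exists>s. (\<forall>x\<in>D. x \<le> s) \<and> (\<forall>u. (\<forall>x\<in>D. x \<le> u) \<longrightarrow> s \<le> u)))"

text \<open>\<open>\<iota>\<close> embeds \<open>'a\<close> as an order dense Riesz subspace of the universally complete space \<open>'u\<close>.
  The universal completion is unique up to a Riesz isomorphism, so \<open>('u, \<iota>)\<close> stands for
  \<open>E\<^sup>u\<close> together with the inclusion of \<open>E\<close>.\<close>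

definition universal_completion :: "('a::riesz_space \<Rightarrow> 'u::riesz_space) \<Rightarrow> bool" where
  "universal_completion \<iota> \<longleftrightarrow>
    dedekind_complete (UNIV :: 'u set) \<and> laterally_complete TYPE('u) \<and>
    linear \<iota> \<and> inj \<iota> \<and>
    (\<forall>x y. \<iota> (sup x y) = sup (\<iota> x) (\<iota> y) \<and> \<iota> (inf x y) = inf (\<iota> x) (\<iota> y)) \<and>
    (\<forall>u>0. \<exists>x. 0 < \<iota> x \<and> \<iota> x \<le> u)"

text \<open>The \<open>f\<close>-algebra multiplication of \<open>'u\<close> is the natural one for the weak order unit \<open>e\<close>.\<close>

definition natural_multiplication :: "('a::riesz_space \<Rightarrow> 'u::f_algebra) \<Rightarrow> 'a \<Rightarrow> bool" where
  "natural_multiplication \<iota> e \<longleftrightarrow>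
    \<iota> e = 1 \<and>
    (\<forall>P Q :: 'u \<Rightarrow> 'u. band_projection P \<and> band_projection Q \<longrightarrow>
      P (\<iota> e) * Q (\<iota> e) = P (Q (\<iota> e)))"

section \<open>Functional calculus on the ideal generated by the unit\<close>

text \<open>\<open>\<Phi>\<close> is a homomorphism of \<open>f\<close>-algebras from \<open>C([a,b])\<close> into the ideal generated by \<open>1\<close>
  which sends the constant \<open>1\<close> to the unit and the identity function to \<open>x\<close>.  Elements of
  \<open>C([a,b])\<close> are represented by functions on \<open>\<real>\<close> that are continuous on \<open>[a,b]\<close>, hence the
  condition that \<open>\<Phi> f\<close> only depends on \<open>f\<close> on \<open>[a,b]\<close>.\<close>

definition functional_calculus ::
  "real \<Rightarrow> real \<Rightarrow> 'u::f_algebra \<Rightarrow> ((real \<Rightarrow> real) \<Rightarrow> 'u) \<Rightarrow> bool" where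
  "functional_calculus a b x \<Phi> \<longleftrightarrow>
    \<Phi> (\<lambda>t. 1) = 1 \<and> \<Phi> (\<lambda>t. t) = x \<and>
    (\<forall>f. continuous_on {a..b} f \<longrightarrow> \<Phi> f \<in> order_ideal hull {1}) \<and>
    (\<forall>f h. continuous_on {a..b} f \<and> (\<forall>t\<in>{a..b}. f t = h t) \<longrightarrow> \<Phi> f = \<Phi> h) \<and>
    (\<forall>c f. continuous_on {a..b} f \<longrightarrow> \<Phi> (\<lambda>t. c * f t) = c *\<^sub>R \<Phi> f) \<and>
    (\<forall>f h. continuous_on {a..b} f \<and> continuous_on {a..b} h \<longrightarrow>
      \<Phi> (\<lambda>t. f t + h t) = \<Phi> f + \<Phi> h \<and>
      \<Phi> (\<lambda>t. f t * h t) = \<Phi> f * \<Phi> h \<and>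
      \<Phi> (\<lambda>t. max (f t) (h t)) = sup (\<Phi> f) (\<Phi> h) \<and>
      \<Phi> (\<lambda>t. min (f t) (h t)) = inf (\<Phi> f) (\<Phi> h))"

text \<open>By Stone-Weierstrass \<open>\<Phi>\<close> is determined by \<open>x\<close> on \<open>C([a,b])\<close>, and for \<open>f\<close> continuous on
  \<open>\<real>\<close> the value \<open>\<Phi> f\<close> does not depend on the interval.\<close>

definition apply_cont :: "(real \<Rightarrow> real) \<Rightarrow> 'u::f_algebra \<Rightarrow> 'u" where
  "apply_cont f x = (THE y. \<exists>a b \<Phi>. functional_calculus a b x \<Phi> \<and> y = \<Phi> f)"

section \<open>Conditional expectation operators\<close>

definition conditional_expectation :: "('a::riesz_space \<Rightarrow> 'a) \<Rightarrow> bool" where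
  "conditional_expectation T \<longleftrightarrow>
    linear T \<and> (\<forall>x. T (T x) = T x) \<and> (\<forall>x\<ge>0. 0 \<le> T x) \<and> order_continuous T \<and>
    riesz_subspace (range T) \<and> dedekind_complete (range T) \<and>
    (\<forall>e. weak_order_unit e \<longrightarrow> weak_order_unit (T e))"

definition strictly_positive :: "('a::riesz_space \<Rightarrow> 'a) \<Rightarrow> bool" where
  "strictly_positive T \<longleftrightarrow> (\<forall>f\<ge>0. T f = 0 \<longrightarrow> f = 0)"

definition T_universally_complete ::
  "('a::riesz_space \<Rightarrow> 'u::riesz_space) \<Rightarrow> ('a \<Rightarrow> 'a) \<Rightarrow> bool" where
  "T_universally_complete \<iota> T \<longleftrightarrow>
    (\<forall>D. directed_up D \<and> (\<forall>f\<in>D. 0 \<le> f) \<and> (\<exists>l u. \<forall>f\<in>D. l \<le> \<iota> (T f) \<and> \<iota> (T f) \<le> u) \<longrightarrow>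
      (\<exists>s. order_conv (increasing_net D) s))"

section \<open>Conditional independence\<close>

definition indep_projections ::
  "('a \<Rightarrow> 'a) \<Rightarrow> 'a::riesz_space \<Rightarrow> ('a \<Rightarrow> 'a) \<Rightarrow> ('a \<Rightarrow> 'a) \<Rightarrow> bool" where
  "indep_projections T e P Q \<longleftrightarrow>
    T (P (T (Q e))) = T (P (Q e)) \<and> T (P (Q e)) = T (Q (T (P e)))"

definition indep_subspaces ::
  "('a \<Rightarrow> 'a) \<Rightarrow> 'a::riesz_space \<Rightarrow> 'a set \<Rightarrow> 'a set \<Rightarrow> bool" where
  "indep_subspaces T e E1 E2 \<longleftrightarrow>
    (\<forall>P Q. band_projection P \<and> band_projection Q \<and> P e \<in> E1 \<and> Q e \<in> E2 \<longrightarrow>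
      indep_projections T e P Q)"

text \<open>Meant for closed Dedekind complete Riesz subspaces \<open>F i\<close> containing \<open>range T\<close>.  The
  subspaces to which it is applied below have these properties automatically when the
  whole space is Dedekind complete.\<close>

definition indep_subspace_family ::
  "('a \<Rightarrow> 'a) \<Rightarrow> 'a::riesz_space \<Rightarrow> 'i set \<Rightarrow> ('i \<Rightarrow> 'a set) \<Rightarrow> bool" where
  "indep_subspace_family T e \<Lambda> F \<longleftrightarrow>
    (\<forall>L1 L2. L1 \<subseteq> \<Lambda> \<and> L2 \<subseteq> \<Lambda> \<and> L1 \<inter> L2 = {} \<longrightarrow>
      indep_subspaces T e (closed_subspace_gen (\<Union>i\<in>L1. F i)) (closed_subspace_gen (\<Union>i\<in>L2. F i)))"

definition indep_elements ::
  "('a \<Rightarrow> 'a) \<Rightarrow> 'a::riesz_space \<Rightarrow> 'i set \<Rightarrow> ('i \<Rightarrow> 'a) \<Rightarrow> bool" where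
  "indep_elements T e \<Lambda> f \<longleftrightarrow>
    indep_subspace_family T e \<Lambda> (\<lambda>i. closed_subspace_gen ({f i} \<union> range T))"

definition indep_projection_family ::
  "('a \<Rightarrow> 'a) \<Rightarrow> 'a::riesz_space \<Rightarrow> 'i set \<Rightarrow> ('i \<Rightarrow> 'a \<Rightarrow> 'a) \<Rightarrow> bool" where
  "indep_projection_family T e \<Lambda> P \<longleftrightarrow> indep_elements T e \<Lambda> (\<lambda>i. P i e)"

end

theory Submission
  imports Defs "HOL-Analysis.Weierstrass_Theorems"
begin

text \<open>The proof follows the classical one for independent events.

  \<^item> A band projection \<open>P\<close> acts like an event.  With \<open>n\<close> fixed, let \<open>Q\<^sub>m\<^sub>,\<^sub>i\<close> be the band projection
    "exactly \<open>i\<close> of the first \<open>m\<close> projections occur" (\<open>exactly\<close>), which satisfies the Pascal recursion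
    \<open>Q\<^sub>m\<^sub>+\<^sub>1\<^sub>,\<^sub>i = P\<^sub>m\<^sub>+\<^sub>1 Q\<^sub>m\<^sub>,\<^sub>i\<^sub>-\<^sub>1 + (I - P\<^sub>m\<^sub>+\<^sub>1) Q\<^sub>m\<^sub>,\<^sub>i\<close>.  The lemma \<open>proj_eq_sum_projections\<close> identifies
    \<open>Q\<^sub>n\<^sub>,\<^sub>j e\<close> with the projection of \<open>e\<close> onto the band where \<open>S\<^sub>n = j e\<close>.

  \<^item> Independence gives \<open>T P\<^sub>m\<^sub>+\<^sub>1 Q\<^sub>m\<^sub>,\<^sub>i e = T P\<^sub>m\<^sub>+\<^sub>1 T Q\<^sub>m\<^sub>,\<^sub>i e\<close>, and the averaging property of \<open>T\<close>
    (\<open>conditional_expectation_averaging\<close>) turns the right-hand side into the product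
    \<open>(T P\<^sub>m\<^sub>+\<^sub>1 e) \<cdot> (T Q\<^sub>m\<^sub>,\<^sub>i e)\<close>.  Since \<open>T P\<^sub>k e = g/n\<close> for every \<open>k\<close>, induction on \<open>m\<close> shows that
    \<open>T Q\<^sub>n\<^sub>,\<^sub>j e\<close> is the binomial probability with parameters \<open>n\<close> and \<open>g/n\<close>.

  \<^item> Here \<open>0 \<le> g \<le> e\<close>, so this binomial probability and the Poisson probability are the images of
    functions on \<open>[0,1]\<close> under the continuous functional calculus \<open>\<Phi>\<close> at \<open>g\<close>.  As \<open>\<Phi>\<close> is positive and
    maps \<open>1\<close> to the unit, it turns a uniform estimate on \<open>[0,1]\<close> into an \<open>e\<close>-uniform one, and
    the assertion becomes the uniform convergence of binomial to Poisson probabilities on \<open>[0,1]\<close>.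

  The averaging property and the functional calculus rest on the same device: an element between \<open>0\<close>
  and the unit is cut into thin horizontal layers, and layers that are not neighbours interact only
  through disjoint elements.  For the functional calculus the layers yield a partition of unity
  by hat functions of \<open>g\<close>, and \<open>\<Phi> f\<close> is the uniform limit of the piecewise linear interpolations of
  \<open>f\<close>; that \<open>\<Phi> (\<lambda>t. exp (- t))\<close> does not depend on how \<open>\<Phi>\<close> is chosen is the Weierstrass approximation
  theorem.\<close>

section \<open>Disjoint elements of Riesz spaces\<close>

lemma inf_add_le:
  fixes x y z :: "'a::riesz_space"
  assumes "0 \<le> x" "0 \<le> y" "0 \<le> z"
  shows "inf (x + y) z \<le> inf x z + inf y z"
proof -
  have "inf x z + inf y z = inf (inf (x + y) (z + y)) (inf (x + z) (z + z))"
    by (simp add: add_inf_distrib_left add_inf_distrib_right inf_aci)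
  moreover have "inf (x + y) z \<le> z + y" "inf (x + y) z \<le> x + z" "inf (x + y) z \<le> z + z"
    using assms by (auto intro: order_trans[OF inf_le2] simp: add_increasing add_increasing2)
  ultimately show ?thesis by simp
qed

lemma disjoint_mono:
  fixes x y :: "'a::riesz_space"
  assumes "inf x y = 0" "0 \<le> x'" "x' \<le> x" "0 \<le> y'" "y' \<le> y"
  shows "inf x' y' = 0"
proof (rule antisym)
  show "inf x' y' \<le> 0" using inf_mono[OF assms(3,5)] assms(1) by simp
qed (use assms in simp)

lemma disjoint_add:
  fixes x y z :: "'a::riesz_space"
  assumes "inf x z = 0" "inf y z = 0"
  shows "inf (x + y) z = 0"
proof -
  have p: "0 \<le> x" "0 \<le> y" "0 \<le> z" using assms inf_le1 inf_le2 by metis+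
  show ?thesis using inf_add_le[OF p] assms p by (simp add: order_antisym)
qed

lemma disjoint_scaleR_left:
  fixes a b :: "'a::riesz_space"
  assumes "inf a b = 0" "0 \<le> c"
  shows "inf (c *\<^sub>R a) b = 0"
proof -
  have p: "0 \<le> a" "0 \<le> b" using assms(1) inf_le1 inf_le2 by metis+
  have n: "inf (real n *\<^sub>R a) b = 0" for n
  proof (induction n)
    case (Suc n)
    then show ?case using disjoint_add[OF assms(1) Suc] by (simp add: scaleR_add_left)
  qed (simp add: p inf_absorb1)
  obtain n where "c \<le> real n" using real_arch_simple by blast
  then show ?thesis
    using p assms(2) by (intro disjoint_mono[OF n[of n]]) (auto intro: scaleR_right_mono scaleR_nonneg_nonneg)
qed

lemma disjoint_scaleR:
  fixes a b :: "'a::riesz_space"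
  assumes "inf a b = 0" "0 \<le> c" "0 \<le> d"
  shows "inf (c *\<^sub>R a) (d *\<^sub>R b) = 0"
  using disjoint_scaleR_left[OF disjoint_scaleR_left[OF assms(1,2), unfolded inf_commute[of _ b]] assms(3)]
  by (simp add: inf_commute)

lemma disjoint_parts:
  fixes x :: "'a::riesz_space"
  shows "inf (sup x 0) (sup (- x) 0) = 0"
proof -
  have "sup (- x) 0 = sup x 0 + (- x)"
    using add_sup_distrib_right[of x 0 "- x"]
    by (simp only: add.right_inverse add_0_left sup_commute[of 0])
  then have "inf (sup x 0) (sup (- x) 0) = sup x 0 + inf 0 (- x)"
    by (metis add.right_neutral add_inf_distrib_left)
  also have "inf 0 (- x) = - sup x 0" by (simp add: inf_commute)
  also have "sup x 0 + - sup x 0 = 0" by (rule add.right_inverse)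
  finally show ?thesis .
qed

lemma pos_minus_neg:
  fixes x :: "'a::riesz_space"
  shows "sup x 0 - sup (- x) 0 = x"
proof -
  have "sup (- x) 0 = sup x 0 + (- x)"
    using add_sup_distrib_right[of x 0 "- x"]
    by (simp only: add.right_inverse add_0_left sup_commute[of 0])
  then show ?thesis by simp
qed

lemma sup_eq_add_of_disjoint:
  fixes x y :: "'a::riesz_space"
  assumes "inf x y = 0" shows "sup x y = x + y"
  using add_eq_inf_sup[of x y] assms by simp

lemma pos_part_eq_of_disjoint_diff:
  fixes a b :: "'a::riesz_space"
  assumes "inf a b = 0" shows "sup (a - b) 0 = a"
proof -
  have "sup (a - b) 0 = sup a b - b"
    using add_sup_distrib_right[of a b "- b"] by simp
  then show ?thesis using sup_eq_add_of_disjoint[OF assms] by simp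
qed

text \<open>Stacking disjoint elements does not increase the height: their sum is their supremum.\<close>

lemma sum_disjoint_le:
  fixes d :: "nat \<Rightarrow> 'a::riesz_space"
  assumes "\<And>i. i < n \<Longrightarrow> 0 \<le> d i" "\<And>i. i < n \<Longrightarrow> d i \<le> w" "0 \<le> w"
    and "\<And>i k. i < k \<Longrightarrow> k < n \<Longrightarrow> inf (d i) (d k) = 0"
  shows "(\<Sum>i<n. d i) \<le> w"
proof -
  have "(\<Sum>i<m. d i) \<le> w \<and> (\<forall>k. m \<le> k \<longrightarrow> k < n \<longrightarrow> inf (\<Sum>i<m. d i) (d k) = 0)"
    if "m \<le> n" for m
    using that
  proof (induction m)
    case 0
    then show ?case using assms by (auto simp: inf_absorb1)
  next
    case (Suc m)
    then have IH: "(\<Sum>i<m. d i) \<le> w" "\<And>k. m \<le> k \<Longrightarrow> k < n \<Longrightarrow> inf (\<Sum>i<m. d i) (d k) = 0"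
      by auto
    have "(\<Sum>i<Suc m. d i) = sup (\<Sum>i<m. d i) (d m)"
      using sup_eq_add_of_disjoint[OF IH(2)[of m]] Suc.prems by simp
    also have "\<dots> \<le> w" using IH(1) assms(2)[of m] Suc.prems by simp
    finally show ?case
      using IH(2) assms(4) Suc.prems by (auto intro: disjoint_add)
  qed
  then show ?thesis by blast
qed

lemma riesz_subspaceD:
  assumes "riesz_subspace F"
  shows "0 \<in> F" "x \<in> F \<Longrightarrow> y \<in> F \<Longrightarrow> x + y \<in> F" "x \<in> F \<Longrightarrow> y \<in> F \<Longrightarrow> x - y \<in> F"
    "x \<in> F \<Longrightarrow> c *\<^sub>R x \<in> F" "x \<in> F \<Longrightarrow> y \<in> F \<Longrightarrow> sup x y \<in> F"
    "x \<in> F \<Longrightarrow> y \<in> F \<Longrightarrow> inf x y \<in> F"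
  using assms unfolding riesz_subspace_def
  by (auto simp: subspace_0 subspace_add subspace_diff subspace_scale)

section \<open>Uniform convergence in Archimedean spaces\<close>

definition archimedean :: "'a::riesz_space itself \<Rightarrow> bool" where
  "archimedean _ \<longleftrightarrow> (\<forall>x y::'a. (\<forall>\<epsilon>>0. x \<le> \<epsilon> *\<^sub>R y) \<longrightarrow> x \<le> 0)"

lemma archimedeanD:
  fixes x y :: "'a::riesz_space"
  assumes "archimedean TYPE('a)" "\<And>\<epsilon>. 0 < \<epsilon> \<Longrightarrow> x \<le> \<epsilon> *\<^sub>R y"
  shows "x \<le> 0"
  using assms unfolding archimedean_def by blast

text \<open>If all multiples \<open>n x\<close> lie below \<open>y\<close>, their supremum \<open>s\<close> exists, and \<open>s - x\<close> is an upper bound as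
  well; hence \<open>x \<le> 0\<close>.\<close>

lemma archimedean_if_dedekind_complete:
  assumes "dedekind_complete (UNIV :: 'a::riesz_space set)"
  shows "archimedean TYPE('a)"
  unfolding archimedean_def
proof (intro allI impI)
  fix x y :: 'a assume xy: "\<forall>\<epsilon>>0. x \<le> \<epsilon> *\<^sub>R y"
  have nx: "real (Suc n) *\<^sub>R x \<le> y" for n
  proof -
    have "x \<le> (1 / real (Suc n)) *\<^sub>R y" using xy by simp
    from scaleR_left_mono[OF this, of "real (Suc n)"] show ?thesis by simp
  qed
  define A where "A = range (\<lambda>n. real (Suc n) *\<^sub>R x)"
  have "A \<subseteq> UNIV" "A \<noteq> {}" "\<exists>u\<in>UNIV. \<forall>a\<in>A. a \<le> u" using nx by (auto simp: A_def)
  then obtain s where s: "\<forall>a\<in>A. a \<le> s" "\<And>u. (\<forall>a\<in>A. a \<le> u) \<Longrightarrow> s \<le> u"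
    using assms unfolding dedekind_complete_def by (metis UNIV_I)
  have "real (Suc n) *\<^sub>R x \<le> s - x" for n
  proof -
    have "real (Suc (Suc n)) *\<^sub>R x \<le> s" using s(1) unfolding A_def by blast
    moreover have "real (Suc (Suc n)) *\<^sub>R x = (real (Suc n) + 1) *\<^sub>R x" by simp
    ultimately have "real (Suc n) *\<^sub>R x + x \<le> s" by (simp only: scaleR_add_left scaleR_one)
    then show ?thesis by (simp only: le_diff_eq)
  qed
  then have "s \<le> s - x" using s(2) unfolding A_def by blast
  then show "x \<le> 0" by simp
qed

lemma e_uniform_convD:
  assumes "e_uniform_conv e h l" "0 < \<epsilon>"
  obtains N where "\<And>n. N \<le> n \<Longrightarrow> \<bar>h n - l\<bar> \<le> \<epsilon> *\<^sub>R e"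
  using assms unfolding e_uniform_conv_def by blast

lemma e_uniform_conv_unique:
  fixes e :: "'a::riesz_space"
  assumes A: "archimedean TYPE('a)" and h: "e_uniform_conv e h l" "e_uniform_conv e h l'"
  shows "l = l'"
proof -
  have "\<bar>l - l'\<bar> \<le> 0"
  proof (rule archimedeanD[OF A])
    fix \<epsilon> :: real assume "0 < \<epsilon>"
    then have e2: "0 < \<epsilon> / 2" by simp
    obtain N where N: "\<And>n. N \<le> n \<Longrightarrow> \<bar>h n - l\<bar> \<le> (\<epsilon> / 2) *\<^sub>R e" using e_uniform_convD[OF h(1) e2] by blast
    obtain M where M: "\<And>n. M \<le> n \<Longrightarrow> \<bar>h n - l'\<bar> \<le> (\<epsilon> / 2) *\<^sub>R e" using e_uniform_convD[OF h(2) e2] by blast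
    let ?n = "max N M"
    have "\<bar>l - l'\<bar> \<le> \<bar>l - h ?n\<bar> + \<bar>h ?n - l'\<bar>"
      using abs_triangle_ineq[of "l - h ?n" "h ?n - l'"] by simp
    also have "\<dots> \<le> (\<epsilon> / 2) *\<^sub>R e + (\<epsilon> / 2) *\<^sub>R e"
      using N[of ?n] M[of ?n] by (intro add_mono) (simp_all add: abs_minus_commute)
    also have "\<dots> = \<epsilon> *\<^sub>R e" by (simp flip: scaleR_add_left)
    finally show "\<bar>l - l'\<bar> \<le> \<epsilon> *\<^sub>R e" .
  qed
  then have "\<bar>l - l'\<bar> = 0" by (simp add: order_antisym)
  then show ?thesis by simp
qed

lemma e_uniform_conv_add:
  fixes e :: "'a::riesz_space"
  assumes "e_uniform_conv e h l" "e_uniform_conv e k m"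
  shows "e_uniform_conv e (\<lambda>n. h n + k n) (l + m)"
  unfolding e_uniform_conv_def
proof (intro allI impI)
  fix \<epsilon> :: real assume "0 < \<epsilon>"
  then have e2: "0 < \<epsilon> / 2" by simp
  obtain N where N: "\<And>n. N \<le> n \<Longrightarrow> \<bar>h n - l\<bar> \<le> (\<epsilon> / 2) *\<^sub>R e" using e_uniform_convD[OF assms(1) e2] by blast
  obtain M where M: "\<And>n. M \<le> n \<Longrightarrow> \<bar>k n - m\<bar> \<le> (\<epsilon> / 2) *\<^sub>R e" using e_uniform_convD[OF assms(2) e2] by blast
  have "\<bar>h n + k n - (l + m)\<bar> \<le> \<epsilon> *\<^sub>R e" if "max N M \<le> n" for n
  proof -
    have "\<bar>h n + k n - (l + m)\<bar> \<le> \<bar>h n - l\<bar> + \<bar>k n - m\<bar>"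
      using abs_triangle_ineq[of "h n - l" "k n - m"] by (simp add: algebra_simps)
    also have "\<dots> \<le> (\<epsilon> / 2) *\<^sub>R e + (\<epsilon> / 2) *\<^sub>R e"
      using N[of n] M[of n] that by (intro add_mono) simp_all
    also have "\<dots> = \<epsilon> *\<^sub>R e" by (simp flip: scaleR_add_left)
    finally show ?thesis .
  qed
  then show "\<exists>N. \<forall>n\<ge>N. \<bar>h n + k n - (l + m)\<bar> \<le> \<epsilon> *\<^sub>R e" by blast
qed

lemma abs_scaleR_riesz:
  fixes x :: "'a::riesz_space"
  shows "\<bar>c *\<^sub>R x\<bar> = \<bar>c\<bar> *\<^sub>R \<bar>x\<bar>"
proof -
  have le: "\<bar>c *\<^sub>R x\<bar> \<le> \<bar>c\<bar> *\<^sub>R \<bar>x\<bar>" for c and x :: 'a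
  proof (cases "0 \<le> c")
    case True
    have "x \<le> \<bar>x\<bar>" "- x \<le> \<bar>x\<bar>" by (simp_all add: abs_ge_self abs_ge_minus_self)
    then show ?thesis
      using scaleR_left_mono[OF \<open>x \<le> \<bar>x\<bar>\<close> True] scaleR_left_mono[OF \<open>- x \<le> \<bar>x\<bar>\<close> True] True
      by (intro abs_leI) simp_all
  next
    case False
    then have n: "0 \<le> - c" by simp
    have "x \<le> \<bar>x\<bar>" "- x \<le> \<bar>x\<bar>" by (simp_all add: abs_ge_self abs_ge_minus_self)
    then show ?thesis
      using scaleR_left_mono[OF \<open>x \<le> \<bar>x\<bar>\<close> n] scaleR_left_mono[OF \<open>- x \<le> \<bar>x\<bar>\<close> n] False
      by (intro abs_leI) simp_all
  qed
  show ?thesis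
  proof (cases "c = 0")
    case False
    have "\<bar>x\<bar> = \<bar>(1 / c) *\<^sub>R (c *\<^sub>R x)\<bar>" using False by simp
    also have "\<dots> \<le> \<bar>1 / c\<bar> *\<^sub>R \<bar>c *\<^sub>R x\<bar>" by (rule le)
    finally have "\<bar>c\<bar> *\<^sub>R \<bar>x\<bar> \<le> \<bar>c\<bar> *\<^sub>R \<bar>1 / c\<bar> *\<^sub>R \<bar>c *\<^sub>R x\<bar>" by (intro scaleR_left_mono) auto
    also have "\<dots> = \<bar>c *\<^sub>R x\<bar>" using False by (simp add: abs_divide)
    finally show ?thesis using le[of c x] by (simp add: order_antisym)
  qed simp
qed

lemma e_uniform_conv_scaleR:
  fixes e :: "'a::riesz_space"
  assumes "e_uniform_conv e h l"
  shows "e_uniform_conv e (\<lambda>n. c *\<^sub>R h n) (c *\<^sub>R l)"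
  unfolding e_uniform_conv_def
proof (intro allI impI)
  fix \<epsilon> :: real assume "0 < \<epsilon>"
  show "\<exists>N. \<forall>n\<ge>N. \<bar>c *\<^sub>R h n - c *\<^sub>R l\<bar> \<le> \<epsilon> *\<^sub>R e"
  proof (cases "c = 0")
    case True
    obtain N where "\<And>n. N \<le> n \<Longrightarrow> \<bar>h n - l\<bar> \<le> \<epsilon> *\<^sub>R e" using e_uniform_convD[OF assms \<open>0 < \<epsilon>\<close>] by blast
    then have "0 \<le> \<epsilon> *\<^sub>R e" using order_trans[OF abs_ge_zero] by blast
    then show ?thesis using True by simp
  next
    case False
    then have "0 < \<epsilon> / \<bar>c\<bar>" using \<open>0 < \<epsilon>\<close> by simp
    then obtain N where N: "\<And>n. N \<le> n \<Longrightarrow> \<bar>h n - l\<bar> \<le> (\<epsilon> / \<bar>c\<bar>) *\<^sub>R e" using e_uniform_convD[OF assms] by blast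
    have "\<bar>c *\<^sub>R h n - c *\<^sub>R l\<bar> \<le> \<epsilon> *\<^sub>R e" if "N \<le> n" for n
    proof -
      have "\<bar>c *\<^sub>R h n - c *\<^sub>R l\<bar> = \<bar>c\<bar> *\<^sub>R \<bar>h n - l\<bar>"
        by (simp flip: scaleR_diff_right add: abs_scaleR_riesz)
      also have "\<dots> \<le> \<bar>c\<bar> *\<^sub>R (\<epsilon> / \<bar>c\<bar>) *\<^sub>R e" using N[OF that] by (intro scaleR_left_mono) auto
      finally show ?thesis using False by simp
    qed
    then show ?thesis by blast
  qed
qed

lemma e_uniform_conv_nonneg:
  fixes e :: "'a::riesz_space"
  assumes A: "archimedean TYPE('a)" and "e_uniform_conv e h l" and h: "\<And>n. N0 \<le> n \<Longrightarrow> 0 \<le> h n"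
  shows "0 \<le> l"
proof -
  have "- l \<le> 0"
  proof (rule archimedeanD[OF A])
    fix \<epsilon> :: real assume "0 < \<epsilon>"
    then obtain N where N: "\<And>n. N \<le> n \<Longrightarrow> \<bar>h n - l\<bar> \<le> \<epsilon> *\<^sub>R e" using e_uniform_convD[OF assms(2)] by blast
    have "- l \<le> h (max N N0) - l" using h[of "max N N0"] by simp
    also have "\<dots> \<le> \<epsilon> *\<^sub>R e" using N[of "max N N0"] abs_ge_self order_trans by (metis max.cobounded1)
    finally show "- l \<le> \<epsilon> *\<^sub>R e" .
  qed
  then show ?thesis by simp
qed

text \<open>The limit is the supremum of the eventual lower bounds of the sequence; by the Cauchy condition
  \<open>h n - \<epsilon> e\<close> is such a lower bound and \<open>h n + \<epsilon> e\<close> lies above all of them.\<close>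

lemma e_uniform_conv_if_Cauchy:
  fixes e :: "'a::riesz_space"
  assumes DC: "dedekind_complete (UNIV :: 'a set)" and e: "0 \<le> e"
    and C: "\<And>\<epsilon>. 0 < \<epsilon> \<Longrightarrow> \<exists>N. \<forall>n\<ge>N. \<forall>m\<ge>N. \<bar>h n - h m\<bar> \<le> \<epsilon> *\<^sub>R e"
  shows "\<exists>l. e_uniform_conv e h l"
proof -
  define A where "A = {a. \<exists>N. \<forall>n\<ge>N. a \<le> h n}"
  have low: "\<exists>N. \<forall>n\<ge>N. h n - \<epsilon> *\<^sub>R e \<in> A \<and> (\<forall>a\<in>A. a \<le> h n + \<epsilon> *\<^sub>R e)" if "0 < \<epsilon>" for \<epsilon>
  proof -
    obtain N where N: "\<And>n m. N \<le> n \<Longrightarrow> N \<le> m \<Longrightarrow> \<bar>h n - h m\<bar> \<le> \<epsilon> *\<^sub>R e" using C[OF \<open>0 < \<epsilon>\<close>] by blast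
    have d: "h n - h m \<le> \<epsilon> *\<^sub>R e" if "N \<le> n" "N \<le> m" for n m
      using N[OF that] abs_ge_self order_trans by blast
    have "h n - \<epsilon> *\<^sub>R e \<in> A \<and> (\<forall>a\<in>A. a \<le> h n + \<epsilon> *\<^sub>R e)" if n: "N \<le> n" for n
    proof (intro conjI ballI)
      have "\<forall>m\<ge>N. h n - \<epsilon> *\<^sub>R e \<le> h m" using d[OF n] by (simp add: algebra_simps)
      then show "h n - \<epsilon> *\<^sub>R e \<in> A" unfolding A_def by blast
      fix a assume "a \<in> A"
      then obtain M where M: "\<And>m. M \<le> m \<Longrightarrow> a \<le> h m" unfolding A_def by blast
      have "a \<le> h (max N M)" using M by simp
      also have "\<dots> \<le> h n + \<epsilon> *\<^sub>R e" using d[of "max N M" n] n by (simp add: algebra_simps)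
      finally show "a \<le> h n + \<epsilon> *\<^sub>R e" .
    qed
    then show ?thesis by blast
  qed
  obtain N where "h N - 1 *\<^sub>R e \<in> A" "\<forall>a\<in>A. a \<le> h N + 1 *\<^sub>R e" using low[of 1] by auto
  then have "A \<noteq> {}" "\<exists>u\<in>UNIV. \<forall>a\<in>A. a \<le> u" by blast+
  then obtain s where s: "\<forall>a\<in>A. a \<le> s" "\<And>u. (\<forall>a\<in>A. a \<le> u) \<Longrightarrow> s \<le> u"
    using DC unfolding dedekind_complete_def by (metis UNIV_I subset_UNIV)
  have "e_uniform_conv e h s"
    unfolding e_uniform_conv_def
  proof (intro allI impI)
    fix \<epsilon> :: real assume "0 < \<epsilon>"
    then obtain N where N: "\<And>n. N \<le> n \<Longrightarrow> h n - \<epsilon> *\<^sub>R e \<in> A \<and> (\<forall>a\<in>A. a \<le> h n + \<epsilon> *\<^sub>R e)"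
      using low by blast
    have "\<bar>h n - s\<bar> \<le> \<epsilon> *\<^sub>R e" if "N \<le> n" for n
    proof (rule abs_leI)
      have "h n - \<epsilon> *\<^sub>R e \<le> s" using N[OF that] s(1) by blast
      then show "h n - s \<le> \<epsilon> *\<^sub>R e" by (simp add: algebra_simps)
      have "s \<le> h n + \<epsilon> *\<^sub>R e" using N[OF that] s(2) by blast
      then show "- (h n - s) \<le> \<epsilon> *\<^sub>R e" by (simp add: algebra_simps)
    qed
    then show "\<exists>N. \<forall>n\<ge>N. \<bar>h n - s\<bar> \<le> \<epsilon> *\<^sub>R e" by blast
  qed
  then show ?thesis by blast
qed

section \<open>Slicing an element into layers\<close>

text \<open>The part of \<open>x\<close> between the heights \<open>s u\<close> and \<open>t u\<close>.  For a function \<open>x\<close> and \<open>u = 1\<close> it is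
  \<open>min (max (x - s) 0) (t - s)\<close>.\<close>

definition layer :: "'a::riesz_space \<Rightarrow> 'a \<Rightarrow> real \<Rightarrow> real \<Rightarrow> 'a" where
  "layer u x s t = inf x (t *\<^sub>R u) - inf x (s *\<^sub>R u)"

lemma layer_nonneg:
  assumes "0 \<le> u" "s \<le> t" shows "0 \<le> layer u x s t"
  using inf_mono[OF order_refl scaleR_right_mono[OF assms(2,1)]] unfolding layer_def
  by (metis diff_ge_0_iff_ge)

lemma layer_le_height:
  assumes "0 \<le> u" "s \<le> t" shows "layer u x s t \<le> (t - s) *\<^sub>R u"
proof -
  have "0 \<le> (t - s) *\<^sub>R u" using assms by (intro scaleR_nonneg_nonneg) auto
  then have "inf x (t *\<^sub>R u) \<le> inf (x + (t - s) *\<^sub>R u) (s *\<^sub>R u + (t - s) *\<^sub>R u)"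
    by (intro inf_mono) (simp_all add: algebra_simps)
  then have "inf x (t *\<^sub>R u) \<le> (t - s) *\<^sub>R u + inf x (s *\<^sub>R u)"
    using add_inf_distrib_right[of x "s *\<^sub>R u" "(t - s) *\<^sub>R u"] by (metis add.commute)
  then show ?thesis unfolding layer_def by (simp only: diff_le_eq)
qed

lemma layer_le_above: "layer u x s t \<le> sup (x - s *\<^sub>R u) 0"
proof -
  have "layer u x s t \<le> x - inf x (s *\<^sub>R u)" unfolding layer_def by simp
  also have "\<dots> = sup (x - s *\<^sub>R u) 0"
    by (simp add: add_sup_distrib_left sup_commute)
  finally show ?thesis .
qed

lemma layer_defect_le_below: "(t - s) *\<^sub>R u - layer u x s t \<le> sup (t *\<^sub>R u - x) 0"
proof -
  have "(t - s) *\<^sub>R u - layer u x s t = t *\<^sub>R u - inf x (t *\<^sub>R u) - (s *\<^sub>R u - inf x (s *\<^sub>R u))"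
    unfolding layer_def by (simp add: algebra_simps del: diff_inf_eq_sup)
  also have "\<dots> \<le> t *\<^sub>R u - inf x (t *\<^sub>R u)"
    using inf_le2[of x "s *\<^sub>R u"] by (metis diff_ge_0_iff_ge diff_left_mono diff_zero)
  also have "\<dots> = sup (t *\<^sub>R u - x) 0"
    by (simp add: add_sup_distrib_left)
  finally show ?thesis .
qed

lemma below_above_disjoint:
  fixes x u :: "'a::riesz_space"
  assumes "0 \<le> u" "t \<le> r"
  shows "inf (sup (t *\<^sub>R u - x) 0) (sup (x - r *\<^sub>R u) 0) = 0"
proof (rule disjoint_mono[OF disjoint_parts[of "t *\<^sub>R u - x"]])
  have "x - r *\<^sub>R u \<le> x - t *\<^sub>R u" using scaleR_right_mono[OF assms(2,1)] by simp
  then show "sup (x - r *\<^sub>R u) 0 \<le> sup (- (t *\<^sub>R u - x)) 0" by (intro sup_mono) auto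
qed auto

text \<open>Where a higher layer is nonzero, the lower layer is already full.\<close>

lemma layer_defect_disjoint:
  assumes "0 \<le> u" "s \<le> t" "t \<le> r" "r \<le> q"
  shows "inf ((t - s) *\<^sub>R u - layer u x s t) (layer u x r q) = 0"
  by (rule disjoint_mono[OF below_above_disjoint[OF assms(1,3), of x]])
    (use assms in \<open>auto simp: layer_nonneg layer_le_height layer_le_above layer_defect_le_below\<close>)

lemma sum_layers:
  "(\<Sum>i<n. layer u x (real i * \<delta>) (real (Suc i) * \<delta>)) = inf x ((real n * \<delta>) *\<^sub>R u) - inf x 0"
  by (induction n) (simp_all add: layer_def del: diff_inf_eq_sup of_nat_Suc)

text \<open>This is the uniqueness of orthomorphisms in an elementary form: a linear map dominated by a Riesz
  homomorphism is determined by its value at \<open>u\<close>.  Cut \<open>h\<close> into layers \<open>l\<close> of thickness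
  \<open>\<delta>\<close>.  As \<open>\<psi> (\<delta> u) = 0\<close>, the elements \<open>l\<close> and \<open>\<delta> u - l\<close> have opposite images, so \<open>\<bar>\<psi> l\<bar>\<close> is
  dominated by \<open>\<rho> (inf l (\<delta> u - l))\<close>.  These infima are disjoint for different layers, hence they add up
  to at most \<open>\<delta> u\<close>, however many layers there are.\<close>

lemma linear_vanishes_if_dominated:
  fixes \<psi> \<rho> :: "'a::riesz_space \<Rightarrow> 'b::riesz_space"
  assumes A: "archimedean TYPE('b)"
    and F: "riesz_subspace F" and u: "u \<in> F" "0 \<le> u"
    and \<psi>: "linear \<psi>" "\<psi> u = 0" and \<rho>: "linear \<rho>" "\<And>x y. \<rho> (inf x y) = inf (\<rho> x) (\<rho> y)"
    and dom: "\<And>k. k \<in> F \<Longrightarrow> 0 \<le> k \<Longrightarrow> \<bar>\<psi> k\<bar> \<le> \<rho> k"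
    and h: "h \<in> F" "0 \<le> h" "h \<le> u"
  shows "\<psi> h = 0"
proof -
  have mono: "\<rho> x \<le> \<rho> y" if "x \<le> y" for x y
    using \<rho>(2)[of x y] that by (metis inf.absorb_iff1)
  have est: "\<bar>\<psi> h\<bar> \<le> (1 / real (Suc N)) *\<^sub>R \<rho> u" for N
  proof -
    define \<delta> where "\<delta> = 1 / real (Suc N)"
    define l where "l i = layer u h (real i * \<delta>) (real (Suc i) * \<delta>)" for i
    have \<delta>: "0 \<le> \<delta>" by (simp add: \<delta>_def)
    have steps: "real i * \<delta> \<le> real (Suc i) * \<delta>" "real (Suc i) * \<delta> - real i * \<delta> = \<delta>" for i :: nat
      using \<delta> by (simp_all add: algebra_simps)
    have l: "0 \<le> l i" "l i \<le> \<delta> *\<^sub>R u" "l i \<in> F" for i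
      using layer_nonneg[OF u(2) steps(1)] layer_le_height[OF u(2) steps(1)]
        riesz_subspaceD[OF F] u(1) h(1)
      unfolding l_def steps(2) by (auto simp: layer_def simp del: diff_inf_eq_sup)
    define d where "d i = inf (l i) (\<delta> *\<^sub>R u - l i)" for i
    have "h = (\<Sum>i<Suc N. l i)"
      using sum_layers[of u h \<delta> "Suc N"] h \<delta>
      by (simp add: l_def \<delta>_def inf_absorb1 inf_absorb2 del: sum.lessThan_Suc of_nat_Suc)
    then have "\<bar>\<psi> h\<bar> \<le> (\<Sum>i<Suc N. \<bar>\<psi> (l i)\<bar>)"
      by (simp add: linear_sum[OF \<psi>(1)] sum_abs del: sum.lessThan_Suc)
    also have "\<dots> \<le> (\<Sum>i<Suc N. \<rho> (d i))"
    proof (rule sum_mono)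
      fix i
      have "\<psi> (\<delta> *\<^sub>R u - l i) = - \<psi> (l i)"
        using \<psi> by (simp add: linear_diff linear_scale)
      then have "\<bar>\<psi> (l i)\<bar> \<le> \<rho> (\<delta> *\<^sub>R u - l i)"
        using dom[of "\<delta> *\<^sub>R u - l i"] l[of i] u F by (simp add: riesz_subspaceD)
      moreover have "\<bar>\<psi> (l i)\<bar> \<le> \<rho> (l i)" using dom l by blast
      ultimately show "\<bar>\<psi> (l i)\<bar> \<le> \<rho> (d i)" by (simp add: d_def \<rho>(2))
    qed
    also have "\<dots> = \<rho> (\<Sum>i<Suc N. d i)" by (simp add: linear_sum[OF \<rho>(1)] del: sum.lessThan_Suc)
    also have "\<dots> \<le> \<rho> (\<delta> *\<^sub>R u)"
    proof (intro mono sum_disjoint_le)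
      fix i k :: nat assume "i < k"
      have "real (Suc i) * \<delta> \<le> real k * \<delta>" using \<open>i < k\<close> \<delta> by (intro mult_right_mono) auto
      from layer_defect_disjoint[OF u(2) steps(1) this steps(1)]
      have "inf (\<delta> *\<^sub>R u - l i) (l k) = 0" unfolding steps(2) l_def .
      then show "inf (d i) (d k) = 0"
        by (rule disjoint_mono) (use l in \<open>auto simp: d_def\<close>)
    qed (use l u \<delta> in \<open>auto simp: d_def scaleR_nonneg_nonneg intro: le_infI1\<close>)
    finally show ?thesis using \<rho> by (simp add: \<delta>_def linear_scale)
  qed
  have pu: "0 \<le> \<rho> u" using dom[OF u] abs_ge_zero order_trans by blast
  have "\<bar>\<psi> h\<bar> \<le> 0"
  proof (rule archimedeanD[OF A])
    fix \<epsilon> :: real assume "0 < \<epsilon>"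
    then obtain N where "inverse (real (Suc N)) < \<epsilon>" using reals_Archimedean by blast
    then have "(1 / real (Suc N)) *\<^sub>R \<rho> u \<le> \<epsilon> *\<^sub>R \<rho> u"
      using pu by (intro scaleR_right_mono) (auto simp: inverse_eq_divide)
    then show "\<bar>\<psi> h\<bar> \<le> \<epsilon> *\<^sub>R \<rho> u" using est[of N] by simp
  qed
  then show ?thesis by (simp add: order_antisym)
qed

section \<open>Unital f-algebras\<close>

instance f_algebra \<subseteq> lattice_ring
proof
  fix a b c :: "'a::f_algebra"
  assume "a \<le> b" "0 \<le> c"
  then have "0 \<le> c * (b - a)" "0 \<le> (b - a) * c"
    by (simp_all add: f_algebra_mult_nonneg)
  then show "c * a \<le> c * b" "a * c \<le> b * c"
    by (simp_all add: right_diff_distrib left_diff_distrib)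
qed

text \<open>The two \<open>f\<close>-algebra axioms turn \<open>a\<close> disjoint from \<open>b\<close> into \<open>a * b\<close> disjoint from \<open>b\<close> and then into
  \<open>a * b\<close> disjoint from itself.\<close>

lemma mult_eq_0_if_disjoint:
  fixes a b :: "'a::f_algebra"
  assumes "inf a b = 0" shows "a * b = 0"
proof -
  have "0 \<le> a" "0 \<le> b" using assms inf_le1 inf_le2 by metis+
  from f_algebra_disjoint_right[OF assms this(2)]
  have "inf b (a * b) = 0" by (simp add: inf_commute)
  from f_algebra_disjoint_left[OF this \<open>0 \<le> a\<close>] show ?thesis by simp
qed

lemma square_nonneg:
  fixes x :: "'a::f_algebra"
  shows "0 \<le> x * x"
proof -
  define p n where "p = sup x 0" and "n = sup (- x) 0"
  have x: "x = p - n" unfolding p_def n_def by (rule pos_minus_neg[symmetric])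
  have d: "inf p n = 0" unfolding p_def n_def by (rule disjoint_parts)
  then have "p * n = 0" "n * p = 0"
    using mult_eq_0_if_disjoint[of p n] mult_eq_0_if_disjoint[of n p] by (simp_all add: inf_commute)
  then have "x * x = p * p + n * n" unfolding x by (simp add: algebra_simps)
  then show ?thesis by (simp add: p_def n_def f_algebra_mult_nonneg)
qed

lemma one_nonneg: "0 \<le> (1 :: 'a::f_algebra)"
  using square_nonneg[of "1 :: 'a"] by simp

text \<open>Since \<open>(1 - r c)\<^sup>2 = 1 - 2 r c\<close> is nonnegative for all \<open>r\<close>, the element \<open>c\<close> is infinitely small
  compared with \<open>1\<close>.\<close>

lemma eq_0_if_square_eq_0:
  fixes c :: "'a::f_algebra"
  assumes A: "archimedean TYPE('a)" and c: "0 \<le> c" "c * c = 0"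
  shows "c = 0"
proof -
  have "c \<le> 0"
  proof (rule archimedeanD[OF A])
    fix \<epsilon> :: real assume \<epsilon>: "0 < \<epsilon>"
    define r where "r = 1 / (2 * \<epsilon>)"
    have two: "(2 * r) *\<^sub>R c = r *\<^sub>R c + r *\<^sub>R c" by (simp only: mult_2 scaleR_add_left)
    have "0 \<le> (1 - r *\<^sub>R c) * (1 - r *\<^sub>R c)" by (rule square_nonneg)
    also have "\<dots> = 1 - (2 * r) *\<^sub>R c"
      unfolding two using c(2) by (simp add: left_diff_distrib right_diff_distrib)
    finally have "\<epsilon> *\<^sub>R ((2 * r) *\<^sub>R c) \<le> \<epsilon> *\<^sub>R 1" using \<epsilon> by (intro scaleR_left_mono) simp_all
    then show "c \<le> \<epsilon> *\<^sub>R 1" using \<epsilon> by (simp add: r_def)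
  qed
  then show ?thesis using c(1) by (simp add: order_antisym)
qed

lemma disjoint_if_mult_eq_0:
  fixes a b :: "'a::f_algebra"
  assumes A: "archimedean TYPE('a)" and "0 \<le> a" "0 \<le> b" "a * b = 0"
  shows "inf a b = 0"
proof (rule eq_0_if_square_eq_0[OF A])
  have "inf a b * inf a b \<le> a * b" using assms by (intro mult_mono) auto
  moreover have "0 \<le> inf a b * inf a b" by (rule square_nonneg)
  ultimately show "inf a b * inf a b = 0" using assms(4) by (simp add: order_antisym)
qed (use assms in simp)

lemma e_uniform_conv_mult:
  fixes h k :: "nat \<Rightarrow> 'a::f_algebra"
  assumes h: "e_uniform_conv 1 h l" and k: "e_uniform_conv 1 k m"
    and bound: "\<And>n. \<bar>h n\<bar> \<le> C *\<^sub>R 1" "\<bar>m\<bar> \<le> D *\<^sub>R 1" and "0 \<le> C" "0 \<le> D"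
  shows "e_uniform_conv 1 (\<lambda>n. h n * k n) (l * m)"
  unfolding e_uniform_conv_def
proof (intro allI impI)
  fix \<epsilon> :: real assume "0 < \<epsilon>"
  define \<delta> where "\<delta> = \<epsilon> / (C + D + 1)"
  have "0 < \<delta>" "\<delta> * (C + D + 1) = \<epsilon>"
    using \<open>0 < \<epsilon>\<close> \<open>0 \<le> C\<close> \<open>0 \<le> D\<close> by (auto simp: \<delta>_def)
  then have \<delta>: "0 < \<delta>" "\<delta> * C + \<delta> * D \<le> \<epsilon>"
    by (simp_all add: distrib_left)
  obtain N where N: "\<And>n. N \<le> n \<Longrightarrow> \<bar>h n - l\<bar> \<le> \<delta> *\<^sub>R 1" using e_uniform_convD[OF h \<delta>(1)] by blast
  obtain M where M: "\<And>n. M \<le> n \<Longrightarrow> \<bar>k n - m\<bar> \<le> \<delta> *\<^sub>R 1" using e_uniform_convD[OF k \<delta>(1)] by blast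
  have "\<bar>h n * k n - l * m\<bar> \<le> \<epsilon> *\<^sub>R 1" if "max N M \<le> n" for n
  proof -
    have "\<bar>h n * k n - l * m\<bar> = \<bar>h n * (k n - m) + (h n - l) * m\<bar>" by (simp add: algebra_simps)
    also have "\<dots> \<le> \<bar>h n * (k n - m)\<bar> + \<bar>(h n - l) * m\<bar>" by (rule abs_triangle_ineq)
    also have "\<dots> \<le> \<bar>h n\<bar> * \<bar>k n - m\<bar> + \<bar>h n - l\<bar> * \<bar>m\<bar>"
      by (intro add_mono abs_le_mult)
    also have "\<dots> \<le> (C *\<^sub>R 1) * (\<delta> *\<^sub>R 1) + (\<delta> *\<^sub>R 1) * (D *\<^sub>R 1)"
      using N[of n] M[of n] that bound one_nonneg \<delta>(1) assms
      by (intro add_mono mult_mono) (auto intro: scaleR_nonneg_nonneg)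
    also have "\<dots> = (\<delta> * C + \<delta> * D) *\<^sub>R 1" by (simp add: scaleR_add_left mult.commute)
    also have "\<dots> \<le> \<epsilon> *\<^sub>R 1" using \<delta>(2) one_nonneg by (rule scaleR_right_mono)
    finally show ?thesis .
  qed
  then show "\<exists>N. \<forall>n\<ge>N. \<bar>h n * k n - l * m\<bar> \<le> \<epsilon> *\<^sub>R 1" by blast
qed

section \<open>Construction of the functional calculus\<close>

text \<open>The tent of height \<open>1\<close> on \<open>[(i - 1)/N, (i + 1)/N]\<close>, applied to \<open>x\<close>.  A tent is \<open>N\<close> times the difference
  of two consecutive layers, the one entered before \<open>i/N\<close> and the one entered after it.\<close>

definition hat :: "'u::f_algebra \<Rightarrow> nat \<Rightarrow> nat \<Rightarrow> 'u" where
  "hat x N i = real N *\<^sub>R (layer 1 x ((real i - 1) / real N) (real i / real N) -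
     layer 1 x (real i / real N) ((real i + 1) / real N))"

text \<open>The piecewise linear interpolation of \<open>f\<close> at the points \<open>i/N\<close>, applied to \<open>x\<close>.\<close>

definition hat_sum :: "'u::f_algebra \<Rightarrow> nat \<Rightarrow> (real \<Rightarrow> real) \<Rightarrow> 'u" where
  "hat_sum x N f = (\<Sum>i\<le>N. f (real i / real N) *\<^sub>R hat x N i)"

definition unit_calculus :: "'u::f_algebra \<Rightarrow> (real \<Rightarrow> real) \<Rightarrow> 'u" where
  "unit_calculus x f = (THE y. e_uniform_conv 1 (\<lambda>N. hat_sum x N f) y)"

lemma grid_steps:
  assumes "0 < N"
  shows "(real i - 1) / real N \<le> real i / real N" "real i / real N \<le> (real i + 1) / real N"
    "real i / real N - (real i - 1) / real N = 1 / real N"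
    "(real i + 1) / real N - real i / real N = 1 / real N"
  using assms by (auto simp: field_simps)

text \<open>Concavity of \<open>s \<mapsto> inf x (s 1)\<close>: the upper layer is disjoint from the defect of the lower one, so it lies
  below the lower layer.\<close>

lemma hat_nonneg:
  assumes "0 < N" shows "0 \<le> hat x N i"
proof -
  let ?s = "(real i - 1) / real N" and ?t = "real i / real N" and ?r = "(real i + 1) / real N"
  note g = grid_steps[OF assms, of i]
  let ?a = "layer 1 x ?s ?t" and ?b = "layer 1 x ?t ?r" and ?d = "(1 / real N) *\<^sub>R (1::'a)"
  have a: "0 \<le> ?a" "?a \<le> ?d" and b: "0 \<le> ?b" "?b \<le> ?d"
    using layer_nonneg[OF one_nonneg g(1), of x] layer_nonneg[OF one_nonneg g(2), of x]
      layer_le_height[OF one_nonneg g(1), of x] layer_le_height[OF one_nonneg g(2), of x]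
    by (simp_all only: g(3,4))
  have dis: "inf (?d - ?a) ?b = 0"
    using layer_defect_disjoint[OF one_nonneg g(1) order_refl g(2), of x] by (simp only: g(3))
  have "?b = inf ((?d - ?a) + ?a) ?b" using b by (simp add: inf_absorb2)
  also have "\<dots> \<le> inf (?d - ?a) ?b + inf ?a ?b" using a b by (intro inf_add_le) simp_all
  also have "\<dots> \<le> ?a" using dis by simp
  finally show ?thesis unfolding hat_def by (intro scaleR_nonneg_nonneg) simp_all
qed

lemma hat_le_above:
  assumes "0 < N" shows "hat x N i \<le> real N *\<^sub>R sup (x - ((real i - 1) / real N) *\<^sub>R 1) 0"
proof -
  note g = grid_steps[OF assms, of i]
  have "layer 1 x ((real i - 1) / real N) (real i / real N) - layer 1 x (real i / real N) ((real i + 1) / real N)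
     \<le> layer 1 x ((real i - 1) / real N) (real i / real N)"
    using layer_nonneg[OF one_nonneg g(2), of x] by simp
  also have "\<dots> \<le> sup (x - ((real i - 1) / real N) *\<^sub>R 1) 0"
    by (rule layer_le_above)
  finally show ?thesis unfolding hat_def by (intro scaleR_left_mono) simp_all
qed

lemma hat_le_below:
  assumes "0 < N" shows "hat x N i \<le> real N *\<^sub>R sup (((real i + 1) / real N) *\<^sub>R 1 - x) 0"
proof -
  note g = grid_steps[OF assms, of i]
  have "layer 1 x ((real i - 1) / real N) (real i / real N) - layer 1 x (real i / real N) ((real i + 1) / real N)
     \<le> (1 / real N) *\<^sub>R 1 - layer 1 x (real i / real N) ((real i + 1) / real N)"
    using layer_le_height[OF one_nonneg g(1), of x] unfolding g(3) by simp
  also have "\<dots> \<le> sup (((real i + 1) / real N) *\<^sub>R 1 - x) 0"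
    using layer_defect_le_below[of "(real i + 1) / real N" "real i / real N" 1 x] unfolding g(4) .
  finally show ?thesis unfolding hat_def by (intro scaleR_left_mono) simp_all
qed

lemma hat_disjoint:
  assumes "0 < N" "0 < M" "(real i + 1) / real N \<le> (real j - 1) / real M"
  shows "inf (hat x N i) (hat x M j) = 0"
  by (rule disjoint_mono[OF disjoint_scaleR[OF below_above_disjoint[OF one_nonneg assms(3), of x],
        of "real N" "real M"]])
    (use assms hat_nonneg hat_le_below hat_le_above in auto)

text \<open>The supports of the two tents, which may have different widths, have no interior point in common.\<close>

lemma hat_mult_eq_0:
  assumes "0 < N" "0 < M" "1 / real N + 1 / real M \<le> \<bar>real i / real N - real j / real M\<bar>"
  shows "hat x N i * hat x M j = 0"
proof -
  have "(real i + 1) / real N \<le> (real j - 1) / real M \<or> (real j + 1) / real M \<le> (real i - 1) / real N"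
    using assms(3) by (auto simp: add_divide_distrib diff_divide_distrib abs_if split: if_splits)
  then have "inf (hat x N i) (hat x M j) = 0"
    using hat_disjoint[OF assms(1,2)] hat_disjoint[OF assms(2,1)] by (metis inf_commute)
  then show ?thesis by (rule mult_eq_0_if_disjoint)
qed

text \<open>Interpolation reproduces the constant \<open>1\<close>, because the sum of tents telescopes, and the identity
  function, by summation by parts.\<close>

lemma
  assumes "0 < N" "0 \<le> x" "x \<le> 1"
  shows sum_hat: "(\<Sum>i\<le>N. hat x N i) = 1"
    and sum_scaled_hat: "(\<Sum>i\<le>N. (real i / real N) *\<^sub>R hat x N i) = x"
proof -
  define d where "d i = layer 1 x ((real i - 1) / real N) (real i / real N)" for i
  have hat: "hat x N i = real N *\<^sub>R (d i - d (Suc i))" for i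
    by (simp add: hat_def d_def add.commute)
  have s0: "d 0 = (1 / real N) *\<^sub>R 1"
  proof -
    have "0 \<le> (1 / real N) *\<^sub>R (1::'a)" by (intro scaleR_nonneg_nonneg one_nonneg) simp
    then have "(- (1 / real N)) *\<^sub>R (1::'a) \<le> 0" by simp
    then have "inf x ((- (1 / real N)) *\<^sub>R 1) = (- (1 / real N)) *\<^sub>R 1"
      using assms(2) order_trans by (intro inf_absorb2) blast
    then show ?thesis
      using assms by (simp add: d_def layer_def inf_absorb2 del: diff_inf_eq_sup)
  qed
  have s1: "d (Suc N) = 0"
  proof -
    have "1 *\<^sub>R (1::'a) \<le> ((1 + real N) / real N) *\<^sub>R 1"
      using assms one_nonneg by (intro scaleR_right_mono) (auto simp: field_simps)
    then have "x \<le> ((1 + real N) / real N) *\<^sub>R 1" using assms(3) by simp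
    then show ?thesis
      using assms by (simp add: d_def layer_def inf_absorb1 del: diff_inf_eq_sup)
  qed
  have "(\<Sum>i\<le>N. hat x N i) = real N *\<^sub>R (\<Sum>i\<le>N. d i - d (Suc i))"
    by (simp only: hat scaleR_right.sum)
  also have "\<dots> = 1" using assms by (simp only: sum_telescope) (simp add: s0 s1)
  finally show "(\<Sum>i\<le>N. hat x N i) = 1" .
  have abel: "(\<Sum>i\<le>m. real i *\<^sub>R (d i - d (Suc i))) = (\<Sum>i<m. d (Suc i)) - real m *\<^sub>R d (Suc m)" for m
  proof (induction m)
    case (Suc m)
    then show ?case
      by (simp add: scaleR_diff_right scaleR_add_left algebra_simps)
  qed simp
  have "(\<Sum>i\<le>N. (real i / real N) *\<^sub>R hat x N i) = (\<Sum>i\<le>N. real i *\<^sub>R (d i - d (Suc i)))"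
    using assms by (intro sum.cong) (simp_all add: hat)
  also have "\<dots> = (\<Sum>i<N. layer 1 x (real i * (1 / real N)) (real (Suc i) * (1 / real N)))"
    unfolding abel s1 by (simp add: d_def)
  also have "\<dots> = x"
    unfolding sum_layers using assms by (simp add: inf_absorb1 inf_absorb2)
  finally show "(\<Sum>i\<le>N. (real i / real N) *\<^sub>R hat x N i) = x" .
qed

text \<open>The tents for \<open>N\<close> and \<open>M\<close> together form a partition of unity \<open>hat x N i * hat x M j\<close> in which
  only the pairs with neighbouring grid points \<open>i/N\<close> and \<open>j/M\<close> survive.  Convergence of the interpolations
  and multiplicativity of their limit both reduce to this estimate.\<close>

lemma hat_double_sum_bound:
  fixes x :: "'u::f_algebra"
  assumes x: "0 \<le> x" "x \<le> 1" and "0 < N" "0 < M" "0 \<le> \<epsilon>"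
    and w: "\<And>i j. i \<le> N \<Longrightarrow> j \<le> M \<Longrightarrow>
      \<bar>real i / real N - real j / real M\<bar> < 1 / real N + 1 / real M \<Longrightarrow> \<bar>w i j\<bar> \<le> \<epsilon>"
  shows "\<bar>\<Sum>i\<le>N. \<Sum>j\<le>M. w i j *\<^sub>R (hat x N i * hat x M j)\<bar> \<le> \<epsilon> *\<^sub>R 1"
proof -
  have "\<bar>\<Sum>i\<le>N. \<Sum>j\<le>M. w i j *\<^sub>R (hat x N i * hat x M j)\<bar>
      \<le> (\<Sum>i\<le>N. \<Sum>j\<le>M. \<bar>w i j *\<^sub>R (hat x N i * hat x M j)\<bar>)"
    by (rule order_trans[OF sum_abs sum_mono[OF sum_abs]])
  also have "\<dots> \<le> (\<Sum>i\<le>N. \<Sum>j\<le>M. \<epsilon> *\<^sub>R (hat x N i * hat x M j))"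
  proof (intro sum_mono)
    fix i j assume ij: "i \<in> {..N}" "j \<in> {..M}"
    have p: "0 \<le> hat x N i * hat x M j"
      using hat_nonneg assms by (intro f_algebra_mult_nonneg) auto
    show "\<bar>w i j *\<^sub>R (hat x N i * hat x M j)\<bar> \<le> \<epsilon> *\<^sub>R (hat x N i * hat x M j)"
    proof (cases "\<bar>real i / real N - real j / real M\<bar> < 1 / real N + 1 / real M")
      case True
      then have "\<bar>w i j\<bar> \<le> \<epsilon>" using w ij by auto
      then show ?thesis using p by (simp add: abs_scaleR_riesz scaleR_right_mono)
    next
      case False
      then have "hat x N i * hat x M j = 0" 
        by (intro hat_mult_eq_0[OF assms(3,4)]) (simp only: not_less)
      then show ?thesis by simp
    qed
  qed
  also have "\<dots> = \<epsilon> *\<^sub>R ((\<Sum>i\<le>N. hat x N i) * (\<Sum>j\<le>M. hat x M j))"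
    by (simp only: sum_product scaleR_right.sum)
  also have "\<dots> = \<epsilon> *\<^sub>R 1"
    using sum_hat[OF assms(3) x] sum_hat[OF assms(4) x] by simp
  finally show ?thesis .
qed

lemma hat_sum_mult:
  "hat_sum x N f * hat_sum x M h =
    (\<Sum>i\<le>N. \<Sum>j\<le>M. (f (real i / real N) * h (real j / real M)) *\<^sub>R (hat x N i * hat x M j))"
  by (simp add: hat_sum_def sum_product mult.commute)

lemma hat_sum_const_1:
  assumes "0 < N" "0 \<le> x" "x \<le> 1" shows "hat_sum x N (\<lambda>t. 1) = 1"
  using sum_hat[OF assms] by (simp add: hat_sum_def)

lemma hat_sum_Cauchy:
  fixes x :: "'u::f_algebra"
  assumes x: "0 \<le> x" "x \<le> 1" and f: "continuous_on {0..1} f" and "0 < \<epsilon>"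
  shows "\<exists>K. \<forall>N\<ge>K. \<forall>M\<ge>K. \<bar>hat_sum x N f - hat_sum x M f\<bar> \<le> \<epsilon> *\<^sub>R 1"
proof -
  have "uniformly_continuous_on {0..1} f" using f by (simp add: compact_uniformly_continuous)
  then obtain \<delta> where \<delta>: "0 < \<delta>"
    "\<And>s t. s \<in> {0..1} \<Longrightarrow> t \<in> {0..1} \<Longrightarrow> \<bar>s - t\<bar> < \<delta> \<Longrightarrow> \<bar>f s - f t\<bar> < \<epsilon>"
    using \<open>0 < \<epsilon>\<close> unfolding uniformly_continuous_on_def dist_real_def by metis
  obtain K where K: "inverse (real (Suc K)) < \<delta> / 2" using reals_Archimedean \<delta>(1) half_gt_zero by blast
  have "\<bar>hat_sum x N f - hat_sum x M f\<bar> \<le> \<epsilon> *\<^sub>R 1" if NM: "Suc K \<le> N" "Suc K \<le> M" for N M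
  proof -
    have pos: "0 < N" "0 < M" using NM by auto
    have "1 / real n < \<delta> / 2" if "Suc K \<le> n" for n
      using le_imp_inverse_le[of "real (Suc K)" "real n"] that K by (simp add: inverse_eq_divide)
    from this[OF NM(1)] this[OF NM(2)] have small: "1 / real N + 1 / real M < \<delta>" by simp
    have "hat_sum x N f - hat_sum x M f =
        hat_sum x N f * hat_sum x M (\<lambda>t. 1) - hat_sum x N (\<lambda>t. 1) * hat_sum x M f"
      using hat_sum_const_1[OF pos(1) x] hat_sum_const_1[OF pos(2) x] by simp
    also have "\<dots> = (\<Sum>i\<le>N. \<Sum>j\<le>M. (f (real i / real N) - f (real j / real M)) *\<^sub>R (hat x N i * hat x M j))"
      by (simp add: hat_sum_mult sum_subtractf scaleR_diff_left)
    also have "\<bar>\<dots>\<bar> \<le> \<epsilon> *\<^sub>R 1"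
    proof (rule hat_double_sum_bound[OF x pos])
      fix i j assume "i \<le> N" "j \<le> M" "\<bar>real i / real N - real j / real M\<bar> < 1 / real N + 1 / real M"
      then show "\<bar>f (real i / real N) - f (real j / real M)\<bar> \<le> \<epsilon>"
        using small pos by (intro less_imp_le \<delta>(2)) (auto simp: field_simps)
    qed (use \<open>0 < \<epsilon>\<close> in simp)
    finally show ?thesis .
  qed
  then show ?thesis by blast
qed

lemma unit_calculus_limit:
  fixes x :: "'u::f_algebra"
  assumes DC: "dedekind_complete (UNIV :: 'u set)" and x: "0 \<le> x" "x \<le> 1"
    and f: "continuous_on {0..1} f"
  shows "e_uniform_conv 1 (\<lambda>N. hat_sum x N f) (unit_calculus x f)"
proof -
  obtain l where l: "e_uniform_conv 1 (\<lambda>N. hat_sum x N f) l"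
    using e_uniform_conv_if_Cauchy[OF DC one_nonneg hat_sum_Cauchy[OF x f]] by blast
  with e_uniform_conv_unique[OF archimedean_if_dedekind_complete[OF DC]] show ?thesis
    unfolding unit_calculus_def by (metis (mono_tags, lifting) theI)
qed

lemma unit_calculus_eqI:
  fixes x :: "'u::f_algebra"
  assumes DC: "dedekind_complete (UNIV :: 'u set)"
    and l: "e_uniform_conv 1 (\<lambda>N. hat_sum x N f) l"
  shows "unit_calculus x f = l"
  unfolding unit_calculus_def
  using l e_uniform_conv_unique[OF archimedean_if_dedekind_complete[OF DC]]
  by (blast intro: the_equality)

lemma e_uniform_conv_eventually_const:
  fixes e :: "'a::riesz_space"
  assumes "0 \<le> e" "\<And>n. N \<le> n \<Longrightarrow> h n = l" shows "e_uniform_conv e h l"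
  unfolding e_uniform_conv_def using assms by (auto intro!: exI[of _ N] scaleR_nonneg_nonneg)

lemma unit_calculus_nonneg:
  fixes x :: "'u::f_algebra"
  assumes DC: "dedekind_complete (UNIV :: 'u set)" and x: "0 \<le> x" "x \<le> 1"
    and f: "continuous_on {0..1} f" "\<And>t. t \<in> {0..1} \<Longrightarrow> 0 \<le> f t"
  shows "0 \<le> unit_calculus x f"
proof (rule e_uniform_conv_nonneg[OF archimedean_if_dedekind_complete[OF DC]
      unit_calculus_limit[OF DC x f(1)]])
  fix N :: nat assume "1 \<le> N"
  then show "0 \<le> hat_sum x N f"
    unfolding hat_sum_def by (intro sum_nonneg scaleR_nonneg_nonneg hat_nonneg f(2)) (auto simp: field_simps)
qed

lemma unit_calculus_add:
  fixes x :: "'u::f_algebra"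
  assumes DC: "dedekind_complete (UNIV :: 'u set)" and x: "0 \<le> x" "x \<le> 1"
    and f: "continuous_on {0..1} f" and h: "continuous_on {0..1} h"
  shows "unit_calculus x (\<lambda>t. f t + h t) = unit_calculus x f + unit_calculus x h"
proof (rule unit_calculus_eqI[OF DC])
  have "hat_sum x N (\<lambda>t. f t + h t) = hat_sum x N f + hat_sum x N h" for N
    by (simp add: hat_sum_def scaleR_add_left sum.distrib)
  then show "e_uniform_conv 1 (\<lambda>N. hat_sum x N (\<lambda>t. f t + h t)) (unit_calculus x f + unit_calculus x h)"
    using e_uniform_conv_add[OF unit_calculus_limit[OF DC x f] unit_calculus_limit[OF DC x h]] by simp
qed

lemma unit_calculus_scaleR:
  fixes x :: "'u::f_algebra"
  assumes DC: "dedekind_complete (UNIV :: 'u set)" and x: "0 \<le> x" "x \<le> 1"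
    and f: "continuous_on {0..1} f"
  shows "unit_calculus x (\<lambda>t. c * f t) = c *\<^sub>R unit_calculus x f"
proof (rule unit_calculus_eqI[OF DC])
  have "hat_sum x N (\<lambda>t. c * f t) = c *\<^sub>R hat_sum x N f" for N
    by (simp add: hat_sum_def scaleR_right.sum)
  then show "e_uniform_conv 1 (\<lambda>N. hat_sum x N (\<lambda>t. c * f t)) (c *\<^sub>R unit_calculus x f)"
    using e_uniform_conv_scaleR[OF unit_calculus_limit[OF DC x f]] by simp
qed

lemma unit_calculus_const_1:
  fixes x :: "'u::f_algebra"
  assumes DC: "dedekind_complete (UNIV :: 'u set)" and x: "0 \<le> x" "x \<le> 1"
  shows "unit_calculus x (\<lambda>t. 1) = 1"
proof -
  have "hat_sum x n (\<lambda>t. 1) = 1" if "1 \<le> n" for n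
    using hat_sum_const_1[of n x] that x by simp
  then show ?thesis
    using unit_calculus_eqI[OF DC e_uniform_conv_eventually_const[OF one_nonneg]] by blast
qed

lemma unit_calculus_id:
  fixes x :: "'u::f_algebra"
  assumes DC: "dedekind_complete (UNIV :: 'u set)" and x: "0 \<le> x" "x \<le> 1"
  shows "unit_calculus x (\<lambda>t. t) = x"
proof -
  have "hat_sum x n (\<lambda>t. t) = x" if "1 \<le> n" for n
    using sum_scaled_hat[of n x] that x by (simp add: hat_sum_def)
  then show ?thesis
    using unit_calculus_eqI[OF DC e_uniform_conv_eventually_const[OF one_nonneg]] by blast
qed

lemma positive_linear_bound:
  fixes \<Phi> :: "(real \<Rightarrow> real) \<Rightarrow> 'u::riesz_space"
  assumes pos: "\<And>f. continuous_on S f \<Longrightarrow> (\<And>t. t \<in> S \<Longrightarrow> 0 \<le> f t) \<Longrightarrow> 0 \<le> \<Phi> f"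
    and add: "\<And>f h. continuous_on S f \<Longrightarrow> continuous_on S h \<Longrightarrow> \<Phi> (\<lambda>t. f t + h t) = \<Phi> f + \<Phi> h"
    and scale: "\<And>c f. continuous_on S f \<Longrightarrow> \<Phi> (\<lambda>t. c * f t) = c *\<^sub>R \<Phi> f"
    and f: "continuous_on S f" "\<And>t. t \<in> S \<Longrightarrow> \<bar>f t\<bar> \<le> C"
  shows "\<bar>\<Phi> f\<bar> \<le> C *\<^sub>R \<Phi> (\<lambda>t. 1)"
proof -
  have *: "c *\<^sub>R \<Phi> f \<le> C *\<^sub>R \<Phi> (\<lambda>t. 1)" if "\<bar>c\<bar> = 1" for c
  proof -
    have "0 \<le> \<Phi> (\<lambda>t. C * 1 + (- c) * f t)"
    proof (intro pos continuous_intros f(1))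
      fix t assume "t \<in> S"
      have "c * f t \<le> \<bar>f t\<bar>" using that by (metis abs_ge_self abs_mult mult_1)
      then show "0 \<le> C * 1 + (- c) * f t" using f(2)[OF \<open>t \<in> S\<close>] by simp
    qed
    also have "\<dots> = \<Phi> (\<lambda>t. C * 1) + \<Phi> (\<lambda>t. (- c) * f t)"
      by (intro add continuous_intros f(1))
    also have "\<dots> = C *\<^sub>R \<Phi> (\<lambda>t. 1) - c *\<^sub>R \<Phi> f"
      using scale[OF continuous_on_const, of C 1] scale[OF f(1), of "- c"] by simp
    finally show ?thesis by simp
  qed
  show ?thesis using *[of 1] *[of "-1"] by (intro abs_leI) simp_all
qed

lemma unit_calculus_bound:
  fixes x :: "'u::f_algebra"
  assumes DC: "dedekind_complete (UNIV :: 'u set)" and x: "0 \<le> x" "x \<le> 1"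
    and f: "continuous_on {0..1} f" "\<And>t. t \<in> {0..1} \<Longrightarrow> \<bar>f t\<bar> \<le> C"
  shows "\<bar>unit_calculus x f\<bar> \<le> C *\<^sub>R 1"
proof -
  have "\<bar>unit_calculus x f\<bar> \<le> C *\<^sub>R unit_calculus x (\<lambda>t. 1)"
    by (rule positive_linear_bound[where S = "{0..1}" and \<Phi> = "unit_calculus x"])
      (simp_all add: unit_calculus_nonneg[OF DC x] unit_calculus_add[OF DC x]
        unit_calculus_scaleR[OF DC x] f del: atLeastAtMost_iff)
  then show ?thesis by (simp only: unit_calculus_const_1[OF DC x])
qed

lemma hat_sum_bound:
  fixes x :: "'u::f_algebra"
  assumes x: "0 \<le> x" "x \<le> 1" and "\<And>t. t \<in> {0..1} \<Longrightarrow> \<bar>f t\<bar> \<le> C" and "0 \<le> C"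
  shows "\<bar>hat_sum x N f\<bar> \<le> C *\<^sub>R 1"
proof (cases "N = 0")
  case True
  then show ?thesis using assms one_nonneg by (simp add: hat_sum_def hat_def scaleR_nonneg_nonneg)
next
  case False
  have "\<bar>hat_sum x N f\<bar> \<le> (\<Sum>i\<le>N. \<bar>f (real i / real N) *\<^sub>R hat x N i\<bar>)"
    unfolding hat_sum_def by (rule sum_abs)
  also have "\<dots> \<le> (\<Sum>i\<le>N. C *\<^sub>R hat x N i)"
    using False assms(3) hat_nonneg[of N x]
    by (intro sum_mono) (auto simp: abs_scaleR_riesz intro!: scaleR_right_mono)
  also have "\<dots> = C *\<^sub>R 1" using sum_hat[of N x] False x by (simp flip: scaleR_right.sum)
  finally show ?thesis .
qed

lemma continuous_bounded_01:
  fixes f :: "real \<Rightarrow> real"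
  assumes "continuous_on {0..1} f"
  obtains C where "0 \<le> C" "\<And>t. t \<in> {0..1} \<Longrightarrow> \<bar>f t\<bar> \<le> C"
proof -
  have "bounded (f ` {0..1})"
    using assms by (intro compact_imp_bounded compact_continuous_image) auto
  then obtain C where C: "\<And>t. t \<in> {0..1} \<Longrightarrow> \<bar>f t\<bar> \<le> C"
    unfolding bounded_iff by (metis imageI real_norm_def)
  from C[of 0] have "0 \<le> C" by simp
  with C that show thesis by blast
qed

text \<open>The product of the interpolations of \<open>f\<close> and \<open>h\<close> and the interpolation of \<open>f h\<close> differ by a double
  sum with coefficients \<open>f(i/N) (h(i/N) - h(j/N))\<close>, which are small for neighbouring grid points.\<close>

lemma unit_calculus_mult:
  fixes x :: "'u::f_algebra"
  assumes DC: "dedekind_complete (UNIV :: 'u set)" and x: "0 \<le> x" "x \<le> 1"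
    and f: "continuous_on {0..1} f" and h: "continuous_on {0..1} h"
  shows "unit_calculus x (\<lambda>t. f t * h t) = unit_calculus x f * unit_calculus x h"
proof -
  obtain C where C: "0 \<le> C" "\<And>t. t \<in> {0..1} \<Longrightarrow> \<bar>f t\<bar> \<le> C" using continuous_bounded_01[OF f] by blast
  obtain D where D: "0 \<le> D" "\<And>t. t \<in> {0..1} \<Longrightarrow> \<bar>h t\<bar> \<le> D" using continuous_bounded_01[OF h] by blast
  have lim: "e_uniform_conv 1 (\<lambda>N. hat_sum x N f * hat_sum x N h) (unit_calculus x f * unit_calculus x h)"
    by (rule e_uniform_conv_mult[OF unit_calculus_limit[OF DC x f] unit_calculus_limit[OF DC x h]
          hat_sum_bound[OF x C(2,1)] unit_calculus_bound[OF DC x h D(2)] C(1) D(1)])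
  have "e_uniform_conv 1 (\<lambda>N. hat_sum x N (\<lambda>t. f t * h t) - hat_sum x N f * hat_sum x N h) 0"
    unfolding e_uniform_conv_def
  proof (intro allI impI)
    fix \<epsilon> :: real assume "0 < \<epsilon>"
    have "uniformly_continuous_on {0..1} h" using h by (simp add: compact_uniformly_continuous)
    moreover have "0 < \<epsilon> / (C + 1)" using \<open>0 < \<epsilon>\<close> C(1) by simp
    ultimately obtain \<delta> where \<delta>: "0 < \<delta>"
      "\<And>s t. s \<in> {0..1} \<Longrightarrow> t \<in> {0..1} \<Longrightarrow> \<bar>s - t\<bar> < \<delta> \<Longrightarrow> \<bar>h s - h t\<bar> < \<epsilon> / (C + 1)"
      unfolding uniformly_continuous_on_def dist_real_def by metis
    obtain K where K: "inverse (real (Suc K)) < \<delta> / 2" using reals_Archimedean \<delta>(1) half_gt_zero by blast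
    have "\<bar>hat_sum x N (\<lambda>t. f t * h t) - hat_sum x N f * hat_sum x N h - 0\<bar> \<le> \<epsilon> *\<^sub>R 1"
      if "Suc K \<le> N" for N
    proof -
      have pos: "0 < N" using that by auto
      have "1 / real N < \<delta> / 2"
        using le_imp_inverse_le[of "real (Suc K)" "real N"] that K by (simp add: inverse_eq_divide)
      then have small: "1 / real N + 1 / real N < \<delta>" by simp
      have "hat_sum x N (\<lambda>t. f t * h t) - hat_sum x N f * hat_sum x N h =
          hat_sum x N (\<lambda>t. f t * h t) * hat_sum x N (\<lambda>t. 1) - hat_sum x N f * hat_sum x N h"
        using hat_sum_const_1[OF pos x] by simp
      also have "\<dots> = (\<Sum>i\<le>N. \<Sum>j\<le>N. (f (real i / real N) * (h (real i / real N) - h (real j / real N)))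
          *\<^sub>R (hat x N i * hat x N j))"
        by (simp add: hat_sum_mult sum_subtractf scaleR_diff_left right_diff_distrib)
      also have "\<bar>\<dots>\<bar> \<le> \<epsilon> *\<^sub>R 1"
      proof (rule hat_double_sum_bound[OF x pos pos])
        fix i j assume ij: "i \<le> N" "j \<le> N" "\<bar>real i / real N - real j / real N\<bar> < 1 / real N + 1 / real N"
        then have in01: "real i / real N \<in> {0..1}" "real j / real N \<in> {0..1}"
          using pos by (auto simp: field_simps)
        have "\<bar>h (real i / real N) - h (real j / real N)\<bar> \<le> \<epsilon> / (C + 1)"
          using small ij(3) in01 by (intro less_imp_le \<delta>(2)) auto
        then have "\<bar>f (real i / real N)\<bar> * \<bar>h (real i / real N) - h (real j / real N)\<bar> \<le> C * (\<epsilon> / (C + 1))"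
          using C in01 by (intro mult_mono) auto
        also have "\<dots> \<le> \<epsilon>" using C(1) \<open>0 < \<epsilon>\<close> by (simp add: field_simps)
        finally show "\<bar>f (real i / real N) * (h (real i / real N) - h (real j / real N))\<bar> \<le> \<epsilon>"
          by (simp add: abs_mult)
      qed (use \<open>0 < \<epsilon>\<close> in simp)
      finally show ?thesis by simp
    qed
    then show "\<exists>K. \<forall>N\<ge>K. \<bar>hat_sum x N (\<lambda>t. f t * h t) - hat_sum x N f * hat_sum x N h - 0\<bar> \<le> \<epsilon> *\<^sub>R 1"
      by blast
  qed
  from e_uniform_conv_add[OF this lim] show ?thesis by (intro unit_calculus_eqI[OF DC]) simp
qed

text \<open>The images of the positive and the negative part of \<open>f\<close> have product \<open>0\<close>, hence are disjoint, hence are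
  the positive and the negative part of the image of \<open>f\<close>.\<close>

lemma unit_calculus_pos_part:
  fixes x :: "'u::f_algebra"
  assumes DC: "dedekind_complete (UNIV :: 'u set)" and x: "0 \<le> x" "x \<le> 1"
    and f: "continuous_on {0..1} f"
  shows "unit_calculus x (\<lambda>t. max (f t) 0) = sup (unit_calculus x f) 0"
proof -
  let ?p = "\<lambda>t. max (f t) 0" and ?n = "\<lambda>t. max (- f t) 0"
  have c: "continuous_on {0..1} ?p" "continuous_on {0..1} ?n" by (intro continuous_intros f)+
  have "unit_calculus x ?p * unit_calculus x ?n = unit_calculus x (\<lambda>t. ?p t * ?n t)"
    by (rule unit_calculus_mult[OF DC x c, symmetric])
  also have "(\<lambda>t. ?p t * ?n t) = (\<lambda>t. 0 * 1)" by (auto simp: max_def fun_eq_iff)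
  also have "unit_calculus x (\<lambda>t. 0 * 1) = 0 *\<^sub>R unit_calculus x (\<lambda>t. 1)"
    by (rule unit_calculus_scaleR[OF DC x]) simp
  finally have "inf (unit_calculus x ?p) (unit_calculus x ?n) = 0"
    by (intro disjoint_if_mult_eq_0[OF archimedean_if_dedekind_complete[OF DC]]
        unit_calculus_nonneg[OF DC x] c) simp_all
  then have "sup (unit_calculus x ?p - unit_calculus x ?n) 0 = unit_calculus x ?p"
    by (rule pos_part_eq_of_disjoint_diff)
  moreover have "unit_calculus x ?p = unit_calculus x (\<lambda>t. f t + ?n t)"
    by (rule arg_cong[where f = "unit_calculus x"]) (auto simp: max_def)
  ultimately show ?thesis using unit_calculus_add[OF DC x f c(2)] by simp
qed

lemma unit_calculus_max:
  fixes x :: "'u::f_algebra"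
  assumes DC: "dedekind_complete (UNIV :: 'u set)" and x: "0 \<le> x" "x \<le> 1"
    and f: "continuous_on {0..1} f" and h: "continuous_on {0..1} h"
  shows "unit_calculus x (\<lambda>t. max (f t) (h t)) = sup (unit_calculus x f) (unit_calculus x h)"
proof -
  have neg: "unit_calculus x (\<lambda>t. f t + (- 1) * h t) = unit_calculus x f - unit_calculus x h"
    using unit_calculus_add[OF DC x f, of "\<lambda>t. (- 1) * h t"] unit_calculus_scaleR[OF DC x h, of "-1"] h
    by (simp add: continuous_on_minus)
  have "unit_calculus x (\<lambda>t. max (f t) (h t)) = unit_calculus x (\<lambda>t. max (f t + (- 1) * h t) 0 + h t)"
    by (rule arg_cong[where f = "unit_calculus x"]) (auto simp: max_def)
  also have "\<dots> = sup (unit_calculus x f - unit_calculus x h) 0 + unit_calculus x h"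
    by (subst unit_calculus_add[OF DC x], (intro continuous_intros f h)+,
        subst unit_calculus_pos_part[OF DC x], (intro continuous_intros f h)+) (simp only: neg)
  also have "\<dots> = sup (unit_calculus x f) (unit_calculus x h)"
    by (simp add: add_sup_distrib_right)
  finally show ?thesis .
qed

lemma unit_calculus_min:
  fixes x :: "'u::f_algebra"
  assumes DC: "dedekind_complete (UNIV :: 'u set)" and x: "0 \<le> x" "x \<le> 1"
    and f: "continuous_on {0..1} f" and h: "continuous_on {0..1} h"
  shows "unit_calculus x (\<lambda>t. min (f t) (h t)) = inf (unit_calculus x f) (unit_calculus x h)"
proof -
  have neg: "unit_calculus x (\<lambda>t. (- 1) * k t) = - unit_calculus x k" if "continuous_on {0..1} k" for k
    using unit_calculus_scaleR[OF DC x that, of "- 1"] by simp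
  have "unit_calculus x (\<lambda>t. min (f t) (h t)) = unit_calculus x (\<lambda>t. (- 1) * max ((- 1) * f t) ((- 1) * h t))"
    by (rule arg_cong[where f = "unit_calculus x"]) (auto simp: max_def min_def)
  also have "\<dots> = - sup (- unit_calculus x f) (- unit_calculus x h)"
    by (subst neg, (intro continuous_intros f h)+,
        subst unit_calculus_max[OF DC x], (intro continuous_intros f h)+) (simp only: neg f h)
  also have "\<dots> = inf (unit_calculus x f) (unit_calculus x h)" by (simp only: inf_eq_neg_sup)
  finally show ?thesis .
qed

lemma functional_calculus_unit_calculus:
  fixes x :: "'u::f_algebra"
  assumes DC: "dedekind_complete (UNIV :: 'u set)" and x: "0 \<le> x" "x \<le> 1"
  shows "functional_calculus 0 1 x (unit_calculus x)"
  unfolding functional_calculus_def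
proof (intro conjI allI impI)
  fix f :: "real \<Rightarrow> real" assume f: "continuous_on {0..1} f"
  obtain C where C: "0 \<le> C" "\<And>t. t \<in> {0..1} \<Longrightarrow> \<bar>f t\<bar> \<le> C" using continuous_bounded_01[OF f] by blast
  have "\<bar>unit_calculus x f\<bar> \<le> \<bar>C *\<^sub>R 1\<bar>"
    using unit_calculus_bound[OF DC x f C(2)] abs_ge_self order_trans by blast
  then show "unit_calculus x f \<in> order_ideal hull {1}"
    unfolding hull_def order_ideal_def by (auto intro: subspace_scale)
next
  fix f h :: "real \<Rightarrow> real" assume fh: "continuous_on {0..1} f \<and> (\<forall>t\<in>{0..1}. f t = h t)"
  have "hat_sum x N f = hat_sum x N h" for N
    unfolding hat_sum_def using fh by (intro sum.cong) (auto simp: divide_le_eq_1)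
  then show "unit_calculus x f = unit_calculus x h" by (simp add: unit_calculus_def)
qed (use unit_calculus_const_1[OF DC x] unit_calculus_id[OF DC x] unit_calculus_scaleR[OF DC x]
    unit_calculus_add[OF DC x] unit_calculus_mult[OF DC x] unit_calculus_max[OF DC x]
    unit_calculus_min[OF DC x] in auto)

section \<open>Uniqueness of the functional calculus\<close>

lemma functional_calculusD:
  assumes "functional_calculus a b x \<Phi>"
  shows "\<Phi> (\<lambda>t. 1) = 1" "\<Phi> (\<lambda>t. t) = x"
    and "continuous_on {a..b} f \<Longrightarrow> \<Phi> (\<lambda>t. c * f t) = c *\<^sub>R \<Phi> f"
    and "continuous_on {a..b} f \<Longrightarrow> continuous_on {a..b} h \<Longrightarrow> \<Phi> (\<lambda>t. f t + h t) = \<Phi> f + \<Phi> h"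
    and "continuous_on {a..b} f \<Longrightarrow> continuous_on {a..b} h \<Longrightarrow> \<Phi> (\<lambda>t. f t * h t) = \<Phi> f * \<Phi> h"
    and "continuous_on {a..b} f \<Longrightarrow> continuous_on {a..b} h \<Longrightarrow> \<Phi> (\<lambda>t. f t - h t) = \<Phi> f - \<Phi> h"
proof -
  show sc: "continuous_on {a..b} f \<Longrightarrow> \<Phi> (\<lambda>t. c * f t) = c *\<^sub>R \<Phi> f" for f c
    using assms unfolding functional_calculus_def by blast
  show add: "continuous_on {a..b} f \<Longrightarrow> continuous_on {a..b} h \<Longrightarrow> \<Phi> (\<lambda>t. f t + h t) = \<Phi> f + \<Phi> h" for f h
    using assms unfolding functional_calculus_def by blast
  show "\<Phi> (\<lambda>t. f t - h t) = \<Phi> f - \<Phi> h" if "continuous_on {a..b} f" "continuous_on {a..b} h"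
    using add[of f "\<lambda>t. (- 1) * h t"] sc[of h "- 1"] that by (simp add: continuous_on_minus)
qed (use assms in \<open>unfold functional_calculus_def, blast+\<close>)

lemma functional_calculus_nonneg:
  assumes \<Phi>: "functional_calculus a b x \<Phi>"
    and f: "continuous_on {a..b} f" "\<And>t. t \<in> {a..b} \<Longrightarrow> 0 \<le> f t"
  shows "0 \<le> \<Phi> f"
proof -
  have "\<Phi> (\<lambda>t. 0 * 1) = 0 *\<^sub>R \<Phi> (\<lambda>t. 1)"
    by (rule functional_calculusD(3)[OF \<Phi> continuous_on_const])
  then have "\<Phi> (\<lambda>t. 0) = 0" by simp
  moreover have "\<Phi> f = \<Phi> (\<lambda>t. max (f t) 0)"
  proof -
    have cong: "\<forall>f h. continuous_on {a..b} f \<and> (\<forall>t\<in>{a..b}. f t = h t) \<longrightarrow> \<Phi> f = \<Phi> h"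
      using \<Phi> unfolding functional_calculus_def by (elim conjE) assumption
    show ?thesis using f by (intro cong[rule_format]) auto
  qed
  moreover have "\<Phi> (\<lambda>t. max (f t) 0) = sup (\<Phi> f) (\<Phi> (\<lambda>t. 0))"
    using \<Phi> f(1) continuous_on_const unfolding functional_calculus_def by blast
  ultimately show ?thesis by (metis sup_ge2)
qed

lemma functional_calculus_bound:
  assumes \<Phi>: "functional_calculus a b x \<Phi>"
    and f: "continuous_on {a..b} f" "\<And>t. t \<in> {a..b} \<Longrightarrow> \<bar>f t\<bar> \<le> C"
  shows "\<bar>\<Phi> f\<bar> \<le> C *\<^sub>R 1"
proof -
  have "\<bar>\<Phi> f\<bar> \<le> C *\<^sub>R \<Phi> (\<lambda>t. 1)"
    by (rule positive_linear_bound[where S = "{a..b}" and \<Phi> = \<Phi>])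
      (simp_all add: functional_calculus_nonneg[OF \<Phi>] functional_calculusD(3,4)[OF \<Phi>] f
          del: atLeastAtMost_iff)
  then show ?thesis by (simp only: functional_calculusD(1)[OF \<Phi>])
qed

lemma functional_calculus_power:
  assumes \<Phi>: "functional_calculus a b x \<Phi>"
  shows "\<Phi> (\<lambda>t. t ^ n) = x ^ n"
proof (induction n)
  case 0
  then show ?case by (simp add: functional_calculusD(1)[OF \<Phi>])
next
  case (Suc n)
  have "\<Phi> (\<lambda>t. t * t ^ n) = \<Phi> (\<lambda>t. t) * \<Phi> (\<lambda>t. t ^ n)"
    by (intro functional_calculusD(5)[OF \<Phi>] continuous_intros)
  then show ?case using Suc by (simp add: functional_calculusD(2)[OF \<Phi>])
qed

lemma functional_calculus_polynomial:
  assumes \<Phi>: "functional_calculus a b x \<Phi>"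
  shows "\<Phi> (\<lambda>t. \<Sum>i\<le>n. c i * t ^ i) = (\<Sum>i\<le>n. c i *\<^sub>R x ^ i)"
proof (induction n)
  case 0
  show ?case
    using functional_calculusD(3)[OF \<Phi> continuous_on_const, of "c 0" 1]
    by (simp add: functional_calculusD(1)[OF \<Phi>])
next
  case (Suc n)
  have "\<Phi> (\<lambda>t. (\<Sum>i\<le>n. c i * t ^ i) + c (Suc n) * t ^ Suc n) =
      \<Phi> (\<lambda>t. \<Sum>i\<le>n. c i * t ^ i) + \<Phi> (\<lambda>t. c (Suc n) * t ^ Suc n)"
    by (intro functional_calculusD(4)[OF \<Phi>] continuous_intros)
  moreover have "\<Phi> (\<lambda>t. c (Suc n) * t ^ Suc n) = c (Suc n) *\<^sub>R \<Phi> (\<lambda>t. t ^ Suc n)"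
    by (intro functional_calculusD(3)[OF \<Phi>] continuous_intros)
  ultimately show ?case
    unfolding Suc functional_calculus_power[OF \<Phi>] by (simp only: sum.atMost_Suc)
qed

text \<open>All functional calculi at \<open>x\<close> agree on polynomials, and each of them is contractive.  The approximating
  polynomial is chosen on an interval that contains the domains of both calculi.\<close>

lemma apply_cont_eq:
  fixes x :: "'u::f_algebra"
  assumes A: "archimedean TYPE('u)" and \<Phi>: "functional_calculus a b x \<Phi>"
    and f: "continuous_on UNIV f"
  shows "apply_cont f x = \<Phi> f"
proof -
  have "\<Psi> f = \<Phi> f" if \<Psi>: "functional_calculus c d x \<Psi>" for c d \<Psi>
  proof -
    have "\<bar>\<Psi> f - \<Phi> f\<bar> \<le> 0"
    proof (rule archimedeanD[OF A])
      fix \<epsilon> :: real assume "0 < \<epsilon>"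
      then have "0 < \<epsilon> / 2" by simp
      obtain p where p: "real_polynomial_function p"
          "\<And>t. t \<in> {min a c..max b d} \<Longrightarrow> \<bar>f t - p t\<bar> < \<epsilon> / 2"
        using Stone_Weierstrass_real_polynomial_function[of "{min a c..max b d}" f "\<epsilon> / 2"]
          continuous_on_subset[OF f subset_UNIV] \<open>0 < \<epsilon> / 2\<close> compact_Icc by metis
      obtain k n where "p = (\<lambda>t. \<Sum>i\<le>n. k i * t ^ i)"
        using p(1) unfolding real_polynomial_function_iff_sum by blast
      then have eq: "\<Psi> p = \<Phi> p"
        by (simp add: functional_calculus_polynomial[OF \<Phi>] functional_calculus_polynomial[OF \<Psi>])
      have cp: "continuous_on S p" for S
        using p(1) by (simp add: continuous_on_polymonial_function real_polynomial_function_eq)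
      have cf: "continuous_on S f" for S using f continuous_on_subset by blast
      have "\<bar>\<Psi> f - \<Psi> p\<bar> \<le> (\<epsilon> / 2) *\<^sub>R 1"
        unfolding functional_calculusD(6)[OF \<Psi> cf cp, symmetric]
        by (intro functional_calculus_bound[OF \<Psi>] continuous_intros cf cp less_imp_le[OF p(2)]) auto
      moreover have "\<bar>\<Phi> f - \<Phi> p\<bar> \<le> (\<epsilon> / 2) *\<^sub>R 1"
        unfolding functional_calculusD(6)[OF \<Phi> cf cp, symmetric]
        by (intro functional_calculus_bound[OF \<Phi>] continuous_intros cf cp less_imp_le[OF p(2)]) auto
      moreover have "\<bar>\<Psi> f - \<Phi> f\<bar> \<le> \<bar>\<Psi> f - \<Psi> p\<bar> + \<bar>\<Phi> f - \<Phi> p\<bar>"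
        using abs_triangle_ineq4[of "\<Psi> f - \<Psi> p" "\<Phi> f - \<Phi> p"] eq by simp
      ultimately have "\<bar>\<Psi> f - \<Phi> f\<bar> \<le> (\<epsilon> / 2) *\<^sub>R 1 + (\<epsilon> / 2) *\<^sub>R 1"
        using add_mono order_trans by blast
      then show "\<bar>\<Psi> f - \<Phi> f\<bar> \<le> \<epsilon> *\<^sub>R 1" by (simp flip: scaleR_add_left)
    qed
    then show ?thesis by (simp add: order_antisym)
  qed
  then show ?thesis
    unfolding apply_cont_def using \<Phi> by (intro the_equality) blast+
qed

section \<open>Band projections\<close>

text \<open>The algebraic description of band projections.  It is stable under the case distinction of
  \<open>order_projection_branch\<close>, so that projections are combined by calculation.\<close>

definition order_projection :: "('a::riesz_space \<Rightarrow> 'a) \<Rightarrow> bool" where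
  "order_projection P \<longleftrightarrow> linear P \<and> (\<forall>x. P (P x) = P x) \<and> (\<forall>x\<ge>0. 0 \<le> P x \<and> P x \<le> x)"

lemma order_projectionD:
  assumes "order_projection P"
  shows "linear P" "P (P x) = P x" "0 \<le> x \<Longrightarrow> 0 \<le> P x" "0 \<le> x \<Longrightarrow> P x \<le> x"
    "P (x + y) = P x + P y" "P (x - y) = P x - P y" "P (c *\<^sub>R x) = c *\<^sub>R P x" "P 0 = 0"
    "P (sum f I) = (\<Sum>i\<in>I. P (f i))"
  using assms unfolding order_projection_def
  by (auto simp: linear_add linear_diff linear_scale linear_0 linear_sum)

lemma order_projection_mono:
  assumes "order_projection P" "x \<le> y" shows "P x \<le> P y"
  using order_projectionD(3)[OF assms(1), of "y - x"] assms
  by (simp add: order_projectionD(6)[OF assms(1)])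

lemma order_projection_fixed_below:
  assumes P: "order_projection P" and "0 \<le> w" "w \<le> y" "P y = y"
  shows "P w = w"
proof -
  have "P (y - w) \<le> y - w" using assms by (intro order_projectionD(4)[OF P]) simp
  then have "w \<le> P w" using assms(4) by (simp add: order_projectionD(6)[OF P])
  then show ?thesis using order_projectionD(4)[OF P assms(2)] by (simp add: order_antisym)
qed

lemma order_projection_abs_le:
  assumes "order_projection P" shows "\<bar>P x\<bar> \<le> P \<bar>x\<bar>"
proof (rule abs_leI)
  show "P x \<le> P \<bar>x\<bar>" by (intro order_projection_mono[OF assms] abs_ge_self)
  have "P (0 - x) \<le> P \<bar>x\<bar>" by (intro order_projection_mono[OF assms]) (simp add: abs_ge_minus_self)
  then show "- P x \<le> P \<bar>x\<bar>"
    using order_projectionD(6)[OF assms, of 0 x] by (simp add: order_projectionD(8)[OF assms])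
qed

text \<open>The range of \<open>Q\<close> is an ideal, so \<open>P (Q z) \<le> Q z\<close> gives \<open>Q P Q = P Q\<close>; in the same way
  \<open>Q P (I - Q) = 0\<close>.\<close>

lemma order_projection_commute:
  assumes P: "order_projection P" and Q: "order_projection Q"
  shows "P (Q x) = Q (P x)"
proof -
  note PD = order_projectionD[OF P] and QD = order_projectionD[OF Q]
  have QPQ: "Q (P (Q z)) = P (Q z)" if "0 \<le> z" for z
    by (rule order_projection_fixed_below[OF Q _ _ QD(2)[of z]])
      (use that QD PD in auto)
  have QPR: "Q (P (z - Q z)) = 0" if "0 \<le> z" for z
  proof (rule order_antisym)
    have z: "0 \<le> z - Q z" using QD(4)[OF that] by simp
    have "Q (P (z - Q z)) \<le> Q (z - Q z)" by (intro order_projection_mono[OF Q] PD(4) z)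
    then show "Q (P (z - Q z)) \<le> 0" by (simp add: QD(2,6))
    show "0 \<le> Q (P (z - Q z))" by (intro QD(3) PD(3) z)
  qed
  have pos: "P (Q z) = Q (P z)" if "0 \<le> z" for z
    using QPQ[OF that] QPR[OF that] by (simp add: QD(6) PD(6))
  have "x = sup x 0 - sup (- x) 0" by (rule pos_minus_neg[symmetric])
  then show ?thesis
    using pos[of "sup x 0"] pos[of "sup (- x) 0"] by (metis PD(6) QD(6) sup_ge2)
qed

lemma order_projection_pos_part:
  assumes P: "order_projection P"
  shows "P (sup x 0) = sup (P x) 0"
proof -
  let ?p = "sup x 0" and ?n = "sup (- x) 0"
  note PD = order_projectionD[OF P]
  have "inf (P ?p) (P ?n) = 0"
    by (rule disjoint_mono[OF disjoint_parts[of x]]) (simp_all add: PD)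
  from pos_part_eq_of_disjoint_diff[OF this] have "sup (P (?p - ?n)) 0 = P ?p" by (simp only: PD(6))
  then show ?thesis by (simp only: pos_minus_neg)
qed

lemma order_projection_disjoint:
  assumes P: "order_projection P" and "P x = 0" "0 \<le> x" "0 \<le> y"
  shows "inf (P y) x = 0"
proof -
  let ?w = "inf (P y) x"
  have w: "0 \<le> ?w" using order_projectionD(3)[OF P assms(4)] assms(3) by simp
  have "P ?w = ?w"
    by (rule order_projection_fixed_below[OF P w _ order_projectionD(2)[OF P, of y]]) simp
  moreover have "P ?w \<le> P x" by (intro order_projection_mono[OF P]) simp
  ultimately show ?thesis using w assms(2) by (simp add: order_antisym)
qed

text \<open>This expresses \<open>P q\<close> through \<open>P e\<close> by a lattice operation.  It keeps the projections built from
  given ones inside every Riesz subspace that contains the given components of \<open>e\<close>.\<close>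

lemma order_projection_eq_inf:
  assumes P: "order_projection P" and q: "0 \<le> q" "q \<le> e"
  shows "P q = inf (P e) q"
proof (rule order_antisym)
  show "P q \<le> inf (P e) q"
    using q order_projection_mono[OF P] order_projectionD(4)[OF P] by simp
  let ?w = "inf (P e) q"
  have w: "0 \<le> ?w" using order_projectionD(3)[OF P, of e] q by simp
  have "?w = P ?w"
    by (rule order_projection_fixed_below[OF P w _ order_projectionD(2)[OF P, of e], symmetric]) simp
  also have "\<dots> \<le> P q" by (intro order_projection_mono[OF P]) simp
  finally show "?w \<le> P q" .
qed

lemma disjoint_compl_diff:
  fixes x y :: "'a::riesz_space"
  assumes "x \<in> disjoint_compl B" "y \<in> disjoint_compl B"
  shows "x - y \<in> disjoint_compl B"
  unfolding disjoint_compl_def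
proof (intro CollectI ballI)
  fix b assume "b \<in> B"
  then have "inf (\<bar>x\<bar> + \<bar>y\<bar>) \<bar>b\<bar> = 0"
    using assms unfolding disjoint_compl_def by (auto intro: disjoint_add)
  then show "inf \<bar>x - y\<bar> \<bar>b\<bar> = 0"
    by (rule disjoint_mono) (auto simp: abs_triangle_ineq4)
qed

lemma disjoint_compl_uminus:
  "x \<in> disjoint_compl B \<Longrightarrow> - x \<in> disjoint_compl B"
  by (simp add: disjoint_compl_def)

lemma disjoint_compl_scaleR:
  fixes x :: "'a::riesz_space"
  assumes "x \<in> disjoint_compl B"
  shows "c *\<^sub>R x \<in> disjoint_compl B"
  using assms unfolding disjoint_compl_def
  by (auto simp: abs_scaleR_riesz intro!: disjoint_scaleR_left)

text \<open>A decomposition \<open>x = p + d\<close> with \<open>p \<in> B\<close> and \<open>d\<close> disjoint from \<open>B\<close> is unique, which gives linearity and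
  idempotence.  If \<open>p + d \<ge> 0\<close> then the negative part of \<open>p\<close> is dominated by both \<open>\<bar>p\<bar>\<close> and \<open>\<bar>d\<bar>\<close>, hence is
  \<open>0\<close>.\<close>

lemma order_projection_if_band_projection:
  assumes "band_projection P" shows "order_projection P"
proof -
  obtain B where B: "band B" and P: "\<And>x. P x \<in> B" "\<And>x. x - P x \<in> disjoint_compl B"
    using assms unfolding band_projection_def by blast
  have sub: "subspace B" using B unfolding band_def order_ideal_def by blast
  have eq0: "y = 0" if "y \<in> B" "y \<in> disjoint_compl B" for y
    using that unfolding disjoint_compl_def by fastforce
  have uniq: "P x = y" if "y \<in> B" "x - y \<in> disjoint_compl B" for x y
  proof -
    have "P x - y \<in> B" using sub that P by (simp add: subspace_diff)
    moreover have "P x - y \<in> disjoint_compl B" using disjoint_compl_diff[OF that(2) P(2)[of x]] by simp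
    ultimately show ?thesis using eq0 by fastforce
  qed
  have add: "P (x + y) = P x + P y" for x y
  proof (rule uniq)
    show "x + y - (P x + P y) \<in> disjoint_compl B"
      using disjoint_compl_diff[OF P(2)[of x] disjoint_compl_uminus[OF P(2)[of y]]]
      by (simp add: algebra_simps)
  qed (simp add: sub P subspace_add)
  have scale: "P (c *\<^sub>R x) = c *\<^sub>R P x" for c x
  proof (rule uniq)
    show "c *\<^sub>R x - c *\<^sub>R P x \<in> disjoint_compl B"
      using disjoint_compl_scaleR[OF P(2)[of x], of c] by (simp add: scaleR_diff_right)
  qed (simp add: sub P subspace_scale)
  have nonneg: "0 \<le> p" if "inf \<bar>p\<bar> \<bar>d\<bar> = 0" "0 \<le> p + d" for p d :: 'a
  proof -
    have "- p \<le> d" using add_left_mono[OF that(2), of "- p"] by simp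
    then have "sup (- p) 0 \<le> inf \<bar>p\<bar> \<bar>d\<bar>"
      using abs_ge_self[of d] abs_ge_minus_self[of p] by (auto intro: order_trans)
    then show ?thesis using that(1) by simp
  qed
  have dis: "inf \<bar>P x\<bar> \<bar>x - P x\<bar> = 0" for x
    using P(1)[of x] P(2)[of x] unfolding disjoint_compl_def by (simp add: inf_commute)
  show ?thesis
    unfolding order_projection_def
  proof (intro conjI allI impI)
    show "linear P" using add scale by (intro linearI)
    show "P (P x) = P x" for x
      using P(1) eq0 by (intro uniq) (auto simp: disjoint_compl_def inf_absorb1)
    fix x :: 'a assume "0 \<le> x"
    show "0 \<le> P x" using nonneg[OF dis[of x]] \<open>0 \<le> x\<close> by simp
    have "inf \<bar>x - P x\<bar> \<bar>P x\<bar> = 0" using dis[of x] by (simp add: inf_commute)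
    from nonneg[OF this] show "P x \<le> x" using \<open>0 \<le> x\<close> by simp
  qed
qed

text \<open>The bounds \<open>y\<close> that witness order convergence have infimum \<open>0\<close>.\<close>

lemma order_conv_bound_le_0:
  fixes u :: "'a::riesz_space"
  assumes "order_conv F l"
    and "\<And>y. 0 \<le> y \<Longrightarrow> eventually (\<lambda>x. \<bar>x - l\<bar> \<le> y) F \<Longrightarrow> u \<le> y"
  shows "u \<le> 0"
  using assms unfolding order_conv_def by blast

text \<open>The band is the range of \<open>P\<close>, which is the set of its fixed points.\<close>

lemma band_projection_if_order_projection:
  assumes P: "order_projection P" shows "band_projection P"
proof -
  note PD = order_projectionD[OF P]
  define B where "B = {x. P x = x}"
  have ideal: "x \<in> B" if "\<bar>x\<bar> \<le> \<bar>y\<bar>" "y \<in> B" for x y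
  proof -
    have "P \<bar>y\<bar> = \<bar>y\<bar>"
      using order_projection_abs_le[OF P, of y] PD(4)[of "\<bar>y\<bar>"] that(2)
      by (simp add: B_def order_antisym)
    then have "P (sup x 0) = sup x 0" "P (sup (- x) 0) = sup (- x) 0"
      using that(1) abs_ge_self[of x] abs_ge_minus_self[of x]
      by (auto intro!: order_projection_fixed_below[OF P, of _ "\<bar>y\<bar>"] intro: order_trans)
    then have "P (sup x 0 - sup (- x) 0) = sup x 0 - sup (- x) 0" by (simp only: PD(6))
    then show ?thesis by (simp only: pos_minus_neg B_def mem_Collect_eq)
  qed
  have "band B"
    unfolding band_def order_ideal_def
  proof (intro conjI allI ballI impI)
    show "subspace B" by (auto simp: B_def PD intro!: subspaceI)
    show "order_closed B"
      unfolding order_closed_def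
    proof (intro allI impI; elim conjE)
      fix F :: "'a filter" and l
      assume F: "F \<noteq> bot" "eventually (\<lambda>x. x \<in> B) F" "order_conv F l"
      have "(1/2) *\<^sub>R \<bar>l - P l\<bar> \<le> 0"
      proof (rule order_conv_bound_le_0[OF F(3)])
        fix y :: 'a assume "0 \<le> y" "eventually (\<lambda>x. \<bar>x - l\<bar> \<le> y) F"
        then obtain x where x: "x \<in> B" "\<bar>x - l\<bar> \<le> y"
          using eventually_happens'[OF F(1)] eventually_conj[OF F(2)] by (metis (mono_tags, lifting))
        have "\<bar>l - P l\<bar> = \<bar>P (x - l) - (x - l)\<bar>" using x(1) by (simp add: B_def PD(6))
        also have "\<dots> \<le> \<bar>P (x - l)\<bar> + \<bar>x - l\<bar>" by (rule abs_triangle_ineq4)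
        also have "\<dots> \<le> P \<bar>x - l\<bar> + \<bar>x - l\<bar>" by (intro add_mono order_projection_abs_le[OF P] order_refl)
        also have "\<dots> \<le> y + y"
          using PD(4)[of "\<bar>x - l\<bar>"] x(2) by (intro add_mono) (auto intro: order_trans)
        finally have "(1/2) *\<^sub>R \<bar>l - P l\<bar> \<le> (1/2) *\<^sub>R (y + y)" by (intro scaleR_left_mono) simp_all
        then show "(1/2) *\<^sub>R \<bar>l - P l\<bar> \<le> y" by (simp flip: scaleR_2)
      qed
      then have "2 *\<^sub>R (1/2) *\<^sub>R \<bar>l - P l\<bar> \<le> 2 *\<^sub>R 0" by (intro scaleR_left_mono) simp_all
      then show "l \<in> B" by (simp add: B_def)
    qed
  qed (use ideal in blast)
  moreover have "x - P x \<in> disjoint_compl B" for x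
    unfolding disjoint_compl_def
  proof (intro CollectI ballI)
    fix b assume "b \<in> B"
    then have "\<bar>b\<bar> \<in> B" using ideal[of "\<bar>b\<bar>" b] by simp
    then have b: "P \<bar>b\<bar> = \<bar>b\<bar>" by (simp add: B_def)
    let ?w = "inf \<bar>x - P x\<bar> \<bar>b\<bar>"
    have regroup: "(p - n) - (p' - n') = (p - p') - (n - n')" for p n p' n' :: 'a
      by (simp add: algebra_simps)
    have "x - P x = (sup x 0 - sup (- x) 0) - P (sup x 0 - sup (- x) 0)"
      by (simp only: pos_minus_neg)
    also have "\<dots> = (sup x 0 - P (sup x 0)) - (sup (- x) 0 - P (sup (- x) 0))"
      by (simp only: PD(6) regroup)
    also have "\<bar>\<dots>\<bar> \<le> (sup x 0 - P (sup x 0)) + (sup (- x) 0 - P (sup (- x) 0))"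
      using abs_triangle_ineq4 PD(4)[of "sup x 0"] PD(4)[of "sup (- x) 0"]
      by (metis abs_of_nonneg diff_ge_0_iff_ge sup_ge2)
    finally have "P ?w \<le> P ((sup x 0 - P (sup x 0)) + (sup (- x) 0 - P (sup (- x) 0)))"
      by (intro order_projection_mono[OF P]) (auto intro: le_infI1)
    also have "\<dots> = 0" by (simp add: PD(2,5,6))
    finally show "?w = 0"
      using order_projection_fixed_below[OF P _ _ b, of ?w] by (simp add: order_antisym)
  qed
  ultimately show ?thesis unfolding band_projection_def by (auto simp: B_def PD(2))
qed

lemma order_projection_id: "order_projection (\<lambda>x. x)"
  by (auto simp: order_projection_def intro!: linearI)

lemma order_projection_0: "order_projection (\<lambda>x. 0)"
  by (auto simp: order_projection_def intro!: linearI)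

text \<open>Apply \<open>Q\<close> where \<open>P\<close> occurs and \<open>R\<close> where it does not.\<close>

lemma order_projection_branch:
  assumes P: "order_projection P" and Q: "order_projection Q" and R: "order_projection R"
  shows "order_projection (\<lambda>x. P (Q x) + (R x - P (R x)))"
proof -
  note PD = order_projectionD[OF P] and QD = order_projectionD[OF Q] and RD = order_projectionD[OF R]
  show ?thesis
    unfolding order_projection_def
  proof (intro conjI allI impI)
    show "linear (\<lambda>x. P (Q x) + (R x - P (R x)))"
      by (intro linearI) (simp_all add: PD QD RD algebra_simps)
    show "P (Q (P (Q x) + (R x - P (R x)))) + (R (P (Q x) + (R x - P (R x))) - P (R (P (Q x) + (R x - P (R x)))))
        = P (Q x) + (R x - P (R x))" for x
      by (simp add: PD QD RD order_projection_commute[OF Q P] order_projection_commute[OF R P])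
    fix x :: 'a assume x: "0 \<le> x"
    have "0 \<le> R x - P (R x)" using RD(3)[OF x] PD(4) by simp
    then show "0 \<le> P (Q x) + (R x - P (R x))" using QD(3)[OF x] PD(3) by simp
    have "P (Q x) \<le> P x" by (intro order_projection_mono[OF P] QD(4) x)
    moreover have "R x - P (R x) \<le> x - P x"
      using PD(4)[of "x - R x"] RD(4)[OF x] by (simp add: PD(6) algebra_simps)
    ultimately show "P (Q x) + (R x - P (R x)) \<le> x"
      using add_mono by fastforce
  qed
qed

section \<open>The projection onto the band where two elements agree\<close>

lemma band_disjoint_from:
  fixes w :: "'a::riesz_space"
  assumes w: "0 \<le> w" shows "band {z. inf \<bar>z\<bar> w = 0}" (is "band ?D")
  unfolding band_def order_ideal_def
proof (intro conjI allI ballI impI)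
  have mono: "x \<in> ?D" if "\<bar>x\<bar> \<le> y" "inf y w = 0" for x y
    using disjoint_mono[OF that(2) abs_ge_zero that(1) w order_refl] by simp
  then show "x \<in> ?D" if "\<bar>x\<bar> \<le> \<bar>y\<bar>" "y \<in> ?D" for x y using that by blast
  show "subspace ?D"
  proof (rule subspaceI)
    show "0 \<in> ?D" using w by (simp add: inf_absorb1)
    show "x + y \<in> ?D" if "x \<in> ?D" "y \<in> ?D" for x y
      using that by (intro mono[OF abs_triangle_ineq] disjoint_add) auto
    show "c *\<^sub>R x \<in> ?D" if "x \<in> ?D" for c x
      using that by (auto simp: abs_scaleR_riesz intro!: disjoint_scaleR_left)
  qed
  show "order_closed ?D"
    unfolding order_closed_def
  proof (intro allI impI; elim conjE)
    fix F :: "'a filter" and l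
    assume F: "F \<noteq> bot" "eventually (\<lambda>x. x \<in> ?D) F" "order_conv F l"
    have "inf \<bar>l\<bar> w \<le> 0"
    proof (rule order_conv_bound_le_0[OF F(3)])
      fix y :: 'a assume "0 \<le> y" "eventually (\<lambda>x. \<bar>x - l\<bar> \<le> y) F"
      then obtain x where x: "x \<in> ?D" "\<bar>x - l\<bar> \<le> y"
        using eventually_happens'[OF F(1)] eventually_conj[OF F(2)] by (metis (mono_tags, lifting))
      have "\<bar>l\<bar> \<le> \<bar>x\<bar> + \<bar>x - l\<bar>" using abs_triangle_ineq4[of x "x - l"] by simp
      then have "inf \<bar>l\<bar> w \<le> inf (\<bar>x\<bar> + \<bar>x - l\<bar>) w" by (intro inf_mono) auto
      also have "\<dots> \<le> inf \<bar>x\<bar> w + inf \<bar>x - l\<bar> w" by (intro inf_add_le w) auto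
      also have "\<dots> \<le> y" using x by (auto intro: le_infI1)
      finally show "inf \<bar>l\<bar> w \<le> y" .
    qed
    then show "l \<in> ?D" using w by (simp add: order_antisym)
  qed
qed

lemma band_gen_disjoint:
  assumes "0 \<le> h" "inf h w = 0" "z \<in> band_gen h"
  shows "inf \<bar>z\<bar> w = 0"
proof -
  have "0 \<le> w" using assms(2) inf_le2 by metis
  then have "band hull {h} \<subseteq> {z. inf \<bar>z\<bar> w = 0}"
    using assms(1,2) by (intro hull_minimal band_disjoint_from) auto
  then show ?thesis using assms(3) unfolding band_gen_def by blast
qed

lemma band_proj_eqI:
  assumes h: "0 \<le> b" "b \<le> h" "0 \<le> r" "inf h r = 0"
  shows "band_proj h (b + r) = b"
  unfolding band_proj_def
proof (rule the_equality)
  have h0: "0 \<le> h" using h(1,2) by (rule order_trans)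
  have "b \<in> S" if "band S" "{h} \<subseteq> S" for S
  proof -
    have "\<bar>b\<bar> \<le> \<bar>h\<bar>" using h(1,2) h0 by simp
    then show ?thesis using that unfolding band_def order_ideal_def by blast
  qed
  then have b: "b \<in> band_gen h" unfolding band_gen_def hull_def by blast
  have r: "r \<in> disjoint_compl (band_gen h)"
    unfolding disjoint_compl_def using band_gen_disjoint[OF h0 h(4)] h(3) by (simp add: inf_commute)
  then show "b \<in> band_gen h \<and> b + r - b \<in> disjoint_compl (band_gen h)" using b by simp
  fix y assume y: "y \<in> band_gen h \<and> b + r - y \<in> disjoint_compl (band_gen h)"
  have "y - b \<in> S" if S: "band S" "{h} \<subseteq> S" for S
  proof -
    have "subspace S" using S unfolding band_def order_ideal_def by blast
    moreover have "y \<in> S" "b \<in> S" using y b S unfolding band_gen_def hull_def by blast+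
    ultimately show ?thesis by (rule subspace_diff)
  qed
  then have "y - b \<in> band_gen h" unfolding band_gen_def hull_def by blast
  moreover have "y - b \<in> disjoint_compl (band_gen h)"
    using disjoint_compl_diff[OF r, of "b + r - y"] y by simp
  ultimately have "inf \<bar>y - b\<bar> \<bar>y - b\<bar> = 0" unfolding disjoint_compl_def by blast
  then show "y = b" by simp
qed

text \<open>Here \<open>a\<close>, \<open>b\<close> and \<open>c\<close> are the components of \<open>a + b + c\<close> where \<open>s = t\<close>, \<open>s > t\<close> and \<open>s < t\<close>.\<close>

lemma proj_eq_eqI:
  assumes "0 \<le> a" "0 \<le> b" "0 \<le> c"
    and "b \<le> sup (s - t) 0" "c \<le> sup (- (s - t)) 0"
    and "inf (sup (s - t) 0) a = 0"
    and "inf (sup (- (s - t)) 0) a = 0" "inf (sup (- (s - t)) 0) b = 0"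
  shows "proj_eq s t (a + b + c) = a"
proof -
  have "inf (sup (- (s - t)) 0) (a + b) = 0"
    using disjoint_add[of a "sup (- (s - t)) 0" b] assms(7,8) by (simp add: inf_commute)
  then have c: "band_proj (sup (- (s - t)) 0) (c + (a + b)) = c"
    using assms by (intro band_proj_eqI) auto
  have b: "band_proj (sup (s - t) 0) (b + a) = b"
    using assms by (intro band_proj_eqI) auto
  show ?thesis
    using b c unfolding proj_eq_def comp_def by (simp add: add.commute add.left_commute)
qed

section \<open>Counting how many projections occur\<close>

text \<open>\<open>exactly P m i\<close> is the projection onto the band where exactly \<open>i\<close> of \<open>P 1, \<dots>, P m\<close> occur.\<close>

fun exactly :: "(nat \<Rightarrow> 'a \<Rightarrow> 'a) \<Rightarrow> nat \<Rightarrow> nat \<Rightarrow> 'a::riesz_space \<Rightarrow> 'a" where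
  "exactly P 0 i x = (if i = 0 then x else 0)"
| "exactly P (Suc m) i x =
    P (Suc m) (if i = 0 then 0 else exactly P m (i - 1) x) + (exactly P m i x - P (Suc m) (exactly P m i x))"

lemma order_projection_exactly:
  assumes "\<And>k. 1 \<le> k \<Longrightarrow> k \<le> m \<Longrightarrow> order_projection (P k)"
  shows "order_projection (exactly P m i)"
  using assms
proof (induction m arbitrary: i)
  case 0
  show ?case by (cases "i = 0") (simp_all add: order_projection_id order_projection_0 cong: if_cong)
next
  case (Suc m)
  have IH: "order_projection (exactly P m l)" for l using Suc by auto
  have "order_projection (\<lambda>x. if i = 0 then 0 else exactly P m (i - 1) x)"
    by (cases "i = 0") (simp_all add: order_projection_0 IH)
  from order_projection_branch[OF Suc.prems[of "Suc m"] this IH[of i]] show ?case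
    by simp
qed

lemma sum_exactly:
  assumes "\<And>k. 1 \<le> k \<Longrightarrow> k \<le> m \<Longrightarrow> order_projection (P k)" and "m \<le> n"
  shows "(\<Sum>i\<le>n. exactly P m i x) = x"
  using assms
proof (induction m arbitrary: n)
  case 0
  show ?case by (simp add: sum.delta)
next
  case (Suc m)
  note PD = order_projectionD[OF Suc.prems(1)[of "Suc m"]]
  obtain n' where n: "n = Suc n'" "m \<le> n'" using Suc.prems(2) by (cases n) auto
  have IH: "(\<Sum>i\<le>n. exactly P m i x) = x" "(\<Sum>i\<le>n'. exactly P m i x) = x"
    using Suc.IH[of n] Suc.IH[of n'] Suc.prems n by auto
  have shift: "(\<Sum>i\<le>n. if i = 0 then 0 else exactly P m (i - 1) x) = x"
    unfolding n(1) sum.atMost_Suc_shift using IH(2) by simp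
  have "(\<Sum>i\<le>n. exactly P (Suc m) i x) =
      P (Suc m) (\<Sum>i\<le>n. if i = 0 then 0 else exactly P m (i - 1) x) +
      ((\<Sum>i\<le>n. exactly P m i x) - P (Suc m) (\<Sum>i\<le>n. exactly P m i x))"
    by (simp only: exactly.simps sum.distrib sum_subtractf PD le_add1 plus_1_eq_Suc order_refl)
  then show ?case unfolding shift IH by simp
qed

lemma exactly_sum_projections:
  assumes "\<And>k. 1 \<le> k \<Longrightarrow> k \<le> m \<Longrightarrow> order_projection (P k)"
  shows "exactly P m i (\<Sum>k=1..m. P k e) = real i *\<^sub>R exactly P m i e"
  using assms
proof (induction m arbitrary: i)
  case 0
  show ?case by simp
next
  case (Suc m)
  define s where "s = (\<Sum>k=1..m. P k e)"
  let ?R = "P (Suc m)"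
  have R: "order_projection ?R" using Suc.prems by simp
  note RD = order_projectionD[OF R]
  have Q: "order_projection (exactly P m l)" for l
    using Suc.prems by (intro order_projection_exactly) simp
  have IH: "exactly P m l s = real l *\<^sub>R exactly P m l e" for l
    unfolding s_def by (rule Suc.IH) (simp add: Suc.prems)
  have QR: "exactly P m l (?R x) = ?R (exactly P m l x)" for l x
    by (rule order_projection_commute[OF Q R])
  have Qadd: "exactly P m l (x + y) = exactly P m l x + exactly P m l y" for l x y
    by (rule order_projectionD(5)[OF Q])
  have sum: "(\<Sum>k=1..Suc m. P k e) = s + ?R e" by (simp add: s_def)
  show ?case
  proof (cases i)
    case 0
    then show ?thesis
      unfolding sum by (simp add: Qadd QR IH RD del: sum.cl_ivl_Suc)
  next
    case (Suc l)
    then show ?thesis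
      unfolding sum by (simp add: Qadd QR IH RD scaleR_add_left algebra_simps del: sum.cl_ivl_Suc)
  qed
qed

lemma exactly_in_riesz_subspace:
  assumes "\<And>k. 1 \<le> k \<Longrightarrow> k \<le> m \<Longrightarrow> order_projection (P k)"
    and F: "riesz_subspace F" "e \<in> F" "0 \<le> e" and PF: "\<And>k. 1 \<le> k \<Longrightarrow> k \<le> m \<Longrightarrow> P k e \<in> F"
  shows "exactly P m i e \<in> F"
  using assms(1) PF
proof (induction m arbitrary: i)
  case 0
  show ?case using F by (simp add: riesz_subspaceD)
next
  case (Suc m)
  have R: "order_projection (P (Suc m))" using Suc.prems by simp
  have IH: "exactly P m l e \<in> F" for l using Suc by auto
  have Q: "order_projection (exactly P m l)" for l
    using Suc.prems by (intro order_projection_exactly) simp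
  have "P (Suc m) (exactly P m l e) = inf (P (Suc m) e) (exactly P m l e)" for l
    using order_projectionD(3,4)[OF Q F(3)] by (intro order_projection_eq_inf[OF R])
  then have "P (Suc m) (exactly P m l e) \<in> F" for l
    using IH Suc.prems(2)[of "Suc m"] by (simp add: riesz_subspaceD(6)[OF F(1)])
  moreover have "P (Suc m) 0 = 0" by (rule order_projectionD(8)[OF R])
  ultimately show ?case
    using IH by (auto intro!: riesz_subspaceD(2,3)[OF F(1)] simp: riesz_subspaceD(1)[OF F(1)])
qed

text \<open>On the band of \<open>exactly P n i\<close> the element \<open>s = S\<^sub>n - j e\<close> equals \<open>(i - j) e\<close>.  As these bands
  decompose the space, the part of \<open>e\<close> with \<open>i > j\<close> lies below the positive part of \<open>s\<close>, the part with \<open>i < j\<close>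
  lies below the negative part, and the part with \<open>i = j\<close> is disjoint from both.\<close>

lemma proj_eq_sum_projections:
  assumes P: "\<And>k. 1 \<le> k \<Longrightarrow> k \<le> n \<Longrightarrow> order_projection (P k)" and e: "0 \<le> e"
  shows "proj_eq (\<Sum>k=1..n. P k e) (real j *\<^sub>R e) e = exactly P n j e"
proof -
  define s where "s = (\<Sum>k=1..n. P k e) - real j *\<^sub>R e"
  define Q where "Q = exactly P n"
  have Q: "order_projection (Q i)" for i unfolding Q_def by (intro order_projection_exactly P)
  note QD = order_projectionD[OF Q]
  have Qe: "0 \<le> Q i e" for i by (intro QD(3) e)
  have Qs: "Q i s = (real i - real j) *\<^sub>R Q i e" for i
    using exactly_sum_projections[of n P i e, OF P]
    by (simp add: s_def QD(6,7) Q_def[symmetric] scaleR_diff_left)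
  have Qneg: "Q i (- s) = - Q i s" for i using QD(6)[of i 0 s] by (simp add: QD(8))
  have pos: "Q i (sup s 0) = (if j < i then (real i - real j) *\<^sub>R Q i e else 0)" for i
    using Qe[of i] scaleR_nonneg_nonneg[of "real i - real j" "Q i e"]
      scaleR_nonpos_nonneg[of "real i - real j" "Q i e"]
    by (auto simp: order_projection_pos_part[OF Q] Qs sup_absorb1 sup_absorb2)
  have neg: "Q i (sup (- s) 0) = (if i < j then (real j - real i) *\<^sub>R Q i e else 0)" for i
    using Qe[of i] scaleR_nonneg_nonneg[of "real j - real i" "Q i e"]
      scaleR_nonpos_nonneg[of "real j - real i" "Q i e"]
    by (auto simp: order_projection_pos_part[OF Q] Qneg Qs sup_absorb1 sup_absorb2 simp flip: scaleR_minus_left)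
  \<comment> \<open>summing up to \<open>n + j\<close> covers all counts and ensures that the index \<open>j\<close> occurs even if \<open>n < j\<close>\<close>
  have total: "x = (\<Sum>i\<le>n + j. Q i x)" for x
    unfolding Q_def by (rule sum_exactly[OF P, symmetric]) simp_all
  define b where "b = (\<Sum>i | i \<le> n + j \<and> j < i. Q i e)"
  define c where "c = (\<Sum>i<j. Q i e)"
  have split: "{..n + j} = insert j ({i. i \<le> n + j \<and> j < i} \<union> {..<j})" by auto
  have dom: "(\<Sum>i\<in>I. Q i e) \<le> y"
    if "I \<subseteq> {..n + j}" "0 \<le> y" "\<And>i. i \<in> I \<Longrightarrow> Q i e \<le> Q i y" for I y
  proof -
    have "(\<Sum>i\<in>I. Q i e) \<le> (\<Sum>i\<in>I. Q i y)" using that(3) by (rule sum_mono)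
    also have "\<dots> \<le> (\<Sum>i\<le>n + j. Q i y)" using that(1,2) QD(3) by (intro sum_mono2) auto
    finally show ?thesis using total[of y] by simp
  qed
  have disj: "inf (sup y 0) (\<Sum>i\<in>I. Q i e) = 0"
    if "finite I" "\<And>i. i \<in> I \<Longrightarrow> Q i (sup y 0) = 0" for I y
    using that
  proof (induction I)
    case empty
    then show ?case by (simp add: inf_absorb2)
  next
    case (insert i I)
    have "inf (Q i e) (sup y 0) = 0"
      using insert.prems e by (intro order_projection_disjoint[OF Q]) auto
    then show ?case
      using disjoint_add[of "Q i e" "sup y 0" "\<Sum>i\<in>I. Q i e"] insert by (simp add: inf_commute)
  qed
  have scale_ge: "q \<le> r *\<^sub>R q" if "1 \<le> r" "0 \<le> q" for r and q :: 'a
    using scaleR_right_mono[OF that] by simp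
  have "e = (\<Sum>i\<in>{..n + j}. Q i e)" using total[of e] by simp
  also have "\<dots> = Q j e + b + c"
    unfolding split b_def c_def
    by (subst sum.insert, simp, simp, subst sum.union_disjoint) (auto simp: add.assoc)
  finally have "proj_eq (\<Sum>k=1..n. P k e) (real j *\<^sub>R e) e =
      proj_eq (\<Sum>k=1..n. P k e) (real j *\<^sub>R e) (Q j e + b + c)"
    by simp
  also have "\<dots> = Q j e"
  proof (rule proj_eq_eqI; (unfold s_def[symmetric])?)
    show "b \<le> sup s 0" unfolding b_def
      using Qe by (intro dom) (auto simp: pos intro!: scale_ge)
    show "c \<le> sup (- s) 0" unfolding c_def
      using Qe by (intro dom) (auto simp: neg intro!: scale_ge)
    show "inf (sup s 0) (Q j e) = 0" using disj[of "{j}" s] by (simp add: pos)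
    show "inf (sup (- s) 0) (Q j e) = 0" using disj[of "{j}" "- s"] by (simp add: neg)
    show "inf (sup (- s) 0) b = 0" unfolding b_def
      by (rule disj) (auto simp: neg)
  qed (use Qe in \<open>auto simp: b_def c_def intro: sum_nonneg\<close>)
  finally show ?thesis by (simp add: Q_def)
qed

section \<open>The averaging property\<close>

text \<open>Both sides are positive linear functions of \<open>h\<close> in the range of \<open>T\<close>, they agree at \<open>h = e\<close>, and they are
  dominated by \<open>\<iota> h\<close> because \<open>P h \<le> h\<close> and \<open>T (P e) \<le> e\<close>.\<close>

lemma conditional_expectation_averaging:
  fixes \<iota> :: "'a::riesz_space \<Rightarrow> 'u::f_algebra"
  assumes A: "archimedean TYPE('u)"
    and \<iota>: "linear \<iota>" "\<And>x y. \<iota> (inf x y) = inf (\<iota> x) (\<iota> y)" "\<iota> e = 1"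
    and T: "linear T" "\<And>x. T (T x) = T x" "\<And>x. 0 \<le> x \<Longrightarrow> 0 \<le> T x" "riesz_subspace (range T)" "T e = e"
    and P: "order_projection P" and e: "0 \<le> e"
    and h: "h \<in> range T" "0 \<le> h" "h \<le> e"
  shows "\<iota> (T (P h)) = \<iota> (T (P e)) * \<iota> h"
proof -
  note PD = order_projectionD[OF P]
  have \<iota>mono: "\<iota> x \<le> \<iota> y" if "x \<le> y" for x y
    using \<iota>(2)[of x y] that by (metis inf.absorb_iff1)
  have Tmono: "T x \<le> T y" if "x \<le> y" for x y
    using T(3)[of "y - x"] that by (simp add: linear_diff[OF T(1)])
  have \<iota>0: "\<iota> 0 = 0" by (rule linear_0[OF \<iota>(1)])
  define \<psi> where "\<psi> k = \<iota> (T (P k)) - \<iota> (T (P e)) * \<iota> k" for k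
  have "\<psi> h = 0"
  proof (rule linear_vanishes_if_dominated[OF A T(4) _ e _ _ \<iota>(1,2) _ h])
    show "e \<in> range T" using T(5) by (metis rangeI)
    show "linear \<psi>"
      by (intro linearI)
        (simp_all add: \<psi>_def PD(5,7) linear_add[OF T(1)] linear_scale[OF T(1)] linear_add[OF \<iota>(1)]
          linear_scale[OF \<iota>(1)] algebra_simps)
    show "\<psi> e = 0" by (simp add: \<psi>_def \<iota>(3))
    fix k assume k: "k \<in> range T" "0 \<le> k"
    have "0 \<le> \<iota> (T (P k))" using \<iota>mono[OF T(3)[OF PD(3)[OF k(2)]]] by (simp add: \<iota>0)
    moreover have "\<iota> (T (P k)) \<le> \<iota> k"
      using \<iota>mono[OF Tmono[OF PD(4)[OF k(2)]]] k(1) T(2) by auto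
    moreover have "0 \<le> \<iota> (T (P e)) * \<iota> k"
      using \<iota>mono[OF T(3)[OF PD(3)[OF e]]] \<iota>mono[OF k(2)] by (simp add: \<iota>0 f_algebra_mult_nonneg)
    moreover have "\<iota> (T (P e)) * \<iota> k \<le> 1 * \<iota> k"
      using \<iota>mono[OF Tmono[OF PD(4)[OF e]]] \<iota>mono[OF k(2)]
      by (intro mult_right_mono) (simp_all add: \<iota>0 \<iota>(3) T(5))
    ultimately show "\<bar>\<psi> k\<bar> \<le> \<iota> k"
      unfolding \<psi>_def by (intro abs_leI) (auto simp: algebra_simps intro: order_trans add_increasing add_increasing2)
  qed
  then show ?thesis by (simp add: \<psi>_def)
qed

section \<open>From binomial to Poisson probabilities\<close>

definition binomial_prob :: "nat \<Rightarrow> nat \<Rightarrow> real \<Rightarrow> real" where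
  "binomial_prob m i s = real (m choose i) * s ^ i * (1 - s) ^ (m - i)"

lemma binomial_prob_0: "binomial_prob 0 i s = (if i = 0 then 1 else 0)"
  by (cases i) (simp_all add: binomial_prob_def)

text \<open>The recursion has the same shape as that of \<open>exactly\<close>, with multiplication by \<open>s\<close> in place of the
  projection.\<close>

lemma binomial_prob_Suc:
  "binomial_prob (Suc m) i s =
    s * (if i = 0 then 0 else binomial_prob m (i - 1) s) + (binomial_prob m i s - s * binomial_prob m i s)"
proof (cases i)
  case (Suc l)
  have "real (m choose Suc l) * (1 - s) ^ (m - l) = real (m choose Suc l) * ((1 - s) * (1 - s) ^ (m - Suc l))"
  proof (cases "Suc l \<le> m")
    case True
    then have "m - l = Suc (m - Suc l)" by simp
    then show ?thesis by simp
  qed simp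
  then have "real (m choose Suc l) * s ^ Suc l * (1 - s) ^ (m - l) =
      (1 - s) * (real (m choose Suc l) * s ^ Suc l * (1 - s) ^ (m - Suc l))"
    by (simp add: mult.commute mult.left_commute)
  then show ?thesis unfolding Suc binomial_prob_def by (simp add: algebra_simps)
qed (simp add: binomial_prob_def algebra_simps)

lemma binomial_coefficient_limit:
  "(\<lambda>n. real (n choose j) * fact j / real n ^ j) \<longlonglongrightarrow> 1"
proof (induction j)
  case (Suc j)
  have "(\<lambda>n. real (n choose j) * fact j / real n ^ j * (1 - real j / real n)) \<longlonglongrightarrow> 1 * (1 - 0)"
    by (intro tendsto_intros Suc lim_const_over_n)
  moreover have "\<forall>\<^sub>F n in sequentially. real (n choose j) * fact j / real n ^ j * (1 - real j / real n)
      = real (n choose Suc j) * fact (Suc j) / real n ^ Suc j"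
  proof (rule eventually_sequentiallyI[of "Suc j"])
    fix n assume n: "Suc j \<le> n"
    have "Suc j * (n choose Suc j) = (n - j) * (n choose j)"
      by (simp only: binomial_absorption binomial_absorb_comp)
    then have "real (Suc j) * real (n choose Suc j) = (real n - real j) * real (n choose j)"
      using n by (metis Suc_leD of_nat_diff of_nat_mult)
    moreover have "real (n choose Suc j) * fact (Suc j) = real (Suc j) * real (n choose Suc j) * fact j"
      by (simp only: fact_Suc mult_ac)
    ultimately have "real (n choose Suc j) * fact (Suc j) = (real n - real j) * real (n choose j) * fact j"
      by (simp only:)
    then show "real (n choose j) * fact j / real n ^ j * (1 - real j / real n)
      = real (n choose Suc j) * fact (Suc j) / real n ^ Suc j"
      using n by (simp add: field_simps)
  qed
  ultimately show ?case by (simp add: tendsto_cong)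
qed simp

text \<open>With \<open>q = 1 - t/n\<close> one has \<open>e\<^sup>-\<^sup>t (1 - 1/n) \<le> q\<^sup>n \<le> e\<^sup>-\<^sup>t\<close>, the lower bound by \<open>1 + x \<le> exp x\<close> and Bernoulli's
  inequality.  Since \<open>1 - 1/n \<le> q \<le> 1\<close>, the power \<open>q\<^sup>n\<^sup>-\<^sup>j\<close> lies between \<open>e\<^sup>-\<^sup>t (1 - 1/n)\<close> and
  \<open>e\<^sup>-\<^sup>t / (1 - 1/n)\<^sup>j\<close>, and the quotients of these bounds by \<open>e\<^sup>-\<^sup>t\<close> do not depend on \<open>t\<close>.\<close>

lemma poisson_limit_theorem_uniform:
  assumes "0 < \<epsilon>"
  shows "\<exists>N\<ge>1. \<forall>n\<ge>N. \<forall>t\<in>{0..1}. \<bar>binomial_prob n j (t / real n) - t ^ j * exp (- t) / fact j\<bar> \<le> \<epsilon>"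
proof -
  define a where "a n = real (n choose j) * fact j / real n ^ j" for n
  have a: "a \<longlonglongrightarrow> 1" unfolding a_def by (rule binomial_coefficient_limit)
  have r: "(\<lambda>n. 1 - 1 / real n) \<longlonglongrightarrow> 1 - 0" by (intro tendsto_intros lim_const_over_n)
  have lo: "(\<lambda>n. a n * (1 - 1 / real n)) \<longlonglongrightarrow> 1 * (1 - 0)" by (intro tendsto_intros a r)
  have hi: "(\<lambda>n. a n / (1 - 1 / real n) ^ j) \<longlonglongrightarrow> 1 / (1 - 0) ^ j" by (intro tendsto_intros a r) simp
  have "\<forall>\<^sub>F n in sequentially. \<bar>a n * (1 - 1 / real n) - 1\<bar> < \<epsilon>"
    using tendstoD[OF lo assms] by (simp add: dist_real_def)
  moreover have "\<forall>\<^sub>F n in sequentially. \<bar>a n / (1 - 1 / real n) ^ j - 1\<bar> < \<epsilon>"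
    using tendstoD[OF hi assms] by (simp add: dist_real_def)
  moreover have "\<forall>\<^sub>F n in sequentially. 2 \<le> n \<and> j \<le> n"
    by (intro eventually_conj eventually_ge_at_top)
  ultimately have "\<forall>\<^sub>F n in sequentially. 2 \<le> n \<and> j \<le> n \<and>
      \<bar>a n * (1 - 1 / real n) - 1\<bar> < \<epsilon> \<and> \<bar>a n / (1 - 1 / real n) ^ j - 1\<bar> < \<epsilon>"
    by eventually_elim simp
  then obtain N where N: "\<And>n. N \<le> n \<Longrightarrow> 2 \<le> n \<and> j \<le> n \<and>
      \<bar>a n * (1 - 1 / real n) - 1\<bar> < \<epsilon> \<and> \<bar>a n / (1 - 1 / real n) ^ j - 1\<bar> < \<epsilon>"
    unfolding eventually_sequentially by blast
  have "\<bar>binomial_prob n j (t / real n) - t ^ j * exp (- t) / fact j\<bar> \<le> \<epsilon>"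
    if n: "N \<le> n" and t: "t \<in> {0..1}" for n t
  proof -
    have n2: "2 \<le> n" "j \<le> n" using N[OF n] by auto
    define q where "q = 1 - t / real n"
    have q: "1 - 1 / real n \<le> q" "0 < 1 - 1 / real n" "q \<le> 1"
      using t n2 by (auto simp: q_def field_simps)
    then have q0: "0 < q" by simp
    define u where "u = t ^ j * exp (- t)"
    have u: "0 \<le> u" "u \<le> 1"
      using t by (auto simp: u_def power_le_one mult_le_one)
    have upper_n: "q ^ n \<le> exp (- t)"
      unfolding q_def using t n2 by (intro exp_ge_one_minus_x_over_n_power_n) auto
    have lower_n: "exp (- t) * (1 - 1 / real n) \<le> q ^ n"
    proof -
      have "1 - (t / real n)\<^sup>2 = q * (1 + t / real n)" by (simp add: q_def power2_eq_square algebra_simps)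
      also have "\<dots> \<le> q * exp (t / real n)" using q0 by (intro mult_left_mono) auto
      finally have base: "1 - (t / real n)\<^sup>2 \<le> q * exp (t / real n)" .
      have tn: "(t / real n)\<^sup>2 \<le> 1" using t n2 by (simp add: power_le_one field_simps)
      have "t\<^sup>2 / real n \<le> 1 / real n" using t n2 by (intro divide_right_mono) (auto simp: power_le_one)
      then have "1 - 1 / real n \<le> 1 - real n * (t / real n)\<^sup>2"
        using n2 by (simp add: power2_eq_square field_simps)
      also have "\<dots> \<le> (1 - (t / real n)\<^sup>2) ^ n"
        using Bernoulli_inequality[of "- (t / real n)\<^sup>2" n] tn by simp
      also have "\<dots> \<le> (q * exp (t / real n)) ^ n" using base tn by (intro power_mono) auto
      also have "\<dots> = q ^ n * exp t"
        using n2 by (simp add: power_mult_distrib flip: exp_of_nat_mult)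
      finally have "exp (- t) * (1 - 1 / real n) \<le> exp (- t) * (q ^ n * exp t)" by (intro mult_left_mono) auto
      then show ?thesis by (simp add: exp_minus field_simps)
    qed
    have "q ^ n \<le> q ^ (n - j)" using q q0 by (intro power_decreasing) auto
    then have lower: "exp (- t) * (1 - 1 / real n) \<le> q ^ (n - j)" using lower_n by simp
    have "q ^ (n - j) * (1 - 1 / real n) ^ j \<le> q ^ (n - j) * q ^ j"
      using q q0 by (intro mult_left_mono power_mono) auto
    also have "\<dots> = q ^ n" using n2 by (simp flip: power_add)
    finally have upper: "q ^ (n - j) \<le> exp (- t) / (1 - 1 / real n) ^ j"
      using upper_n q(2) by (simp add: pos_le_divide_eq)
    have an: "0 \<le> a n" by (simp add: a_def)
    have b: "fact j * binomial_prob n j (t / real n) = a n * t ^ j * q ^ (n - j)"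
      using n2 by (simp add: binomial_prob_def a_def q_def power_divide)
    have "a n * t ^ j * (exp (- t) * (1 - 1 / real n)) \<le> fact j * binomial_prob n j (t / real n)"
      unfolding b using lower an t by (intro mult_left_mono) auto
    then have L: "u * (a n * (1 - 1 / real n) - 1) \<le> fact j * binomial_prob n j (t / real n) - u"
      by (simp add: u_def algebra_simps)
    have "fact j * binomial_prob n j (t / real n) \<le> a n * t ^ j * (exp (- t) / (1 - 1 / real n) ^ j)"
      unfolding b using upper an t by (intro mult_left_mono) auto
    then have U: "fact j * binomial_prob n j (t / real n) - u \<le> u * (a n / (1 - 1 / real n) ^ j - 1)"
      by (simp add: u_def algebra_simps)
    have "- \<epsilon> \<le> u * (a n * (1 - 1 / real n) - 1)"
    proof -
      have "\<bar>u * (a n * (1 - 1 / real n) - 1)\<bar> \<le> 1 * \<epsilon>"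
        unfolding abs_mult using u N[OF n] by (intro mult_mono) auto
      from abs_le_D2[OF this] show ?thesis by (subst minus_le_iff) (simp only: mult_1)
    qed
    moreover have "u * (a n / (1 - 1 / real n) ^ j - 1) \<le> \<epsilon>"
    proof -
      have "\<bar>u * (a n / (1 - 1 / real n) ^ j - 1)\<bar> \<le> 1 * \<epsilon>"
        unfolding abs_mult using u N[OF n] by (intro mult_mono) auto
      then show ?thesis by simp
    qed
    ultimately have "\<bar>fact j * binomial_prob n j (t / real n) - u\<bar> \<le> \<epsilon>" using L U by simp
    also have "\<dots> \<le> fact j * \<epsilon>" using assms fact_ge_1[of j, where 'a = real] by simp
    finally have "fact j * \<bar>binomial_prob n j (t / real n) - u / fact j\<bar> \<le> fact j * \<epsilon>"
      by (simp add: abs_mult_pos' algebra_simps)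
    then show ?thesis by (simp add: u_def)
  qed
  moreover have "1 \<le> N" using N[of N] by simp
  ultimately show ?thesis by blast
qed

section \<open>The Poisson limit theorem\<close>

text \<open>The component \<open>exactly (P n) m i e\<close> lies in the closed Riesz subspace generated by the subspaces of the
  first \<open>m\<close> projections, so independence applies to the index sets \<open>{(n, m + 1)}\<close> and
  \<open>{(n, 1), \<dots>, (n, m)}\<close>.  For \<open>m = 0\<close> the second set is empty and generates only the zero subspace; there
  the identity follows from \<open>T e = e\<close>.\<close>

lemma indep_projection_step:
  assumes indep: "indep_projection_family T e {(n, k). 1 \<le> k \<and> k \<le> n} (\<lambda>(n, k). P n k)"
    and P: "\<And>k. 1 \<le> k \<Longrightarrow> k \<le> n \<Longrightarrow> band_projection (P n k)"
    and T: "linear T" "T e = e" and e: "0 \<le> e" and m: "Suc m \<le> n"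
  shows "T (P n (Suc m) (T (exactly (P n) m i e))) = T (P n (Suc m) (exactly (P n) m i e))"
proof (cases "m = 0")
  case True
  then show ?thesis using T by (simp add: linear_0)
next
  case False
  let ?F = "\<lambda>q. closed_subspace_gen ({(case q of (n, k) \<Rightarrow> P n k) e} \<union> range T)"
  let ?L1 = "{(n, Suc m)}" and ?L2 = "{(n, k) |k. 1 \<le> k \<and> k \<le> m}"
  have op: "order_projection (P n k)" if "1 \<le> k" "k \<le> n" for k
    using P that by (intro order_projection_if_band_projection)
  have "indep_subspace_family T e {(n, k). 1 \<le> k \<and> k \<le> n} ?F"
    using indep unfolding indep_projection_family_def indep_elements_def .
  then have "?L1 \<subseteq> {(n, k). 1 \<le> k \<and> k \<le> n} \<and> ?L2 \<subseteq> {(n, k). 1 \<le> k \<and> k \<le> n} \<and> ?L1 \<inter> ?L2 = {} \<longrightarrow>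
      indep_subspaces T e (closed_subspace_gen (\<Union>q\<in>?L1. ?F q)) (closed_subspace_gen (\<Union>q\<in>?L2. ?F q))"
    unfolding indep_subspace_family_def by (elim allE)
  then have "indep_subspaces T e (closed_subspace_gen (\<Union>q\<in>?L1. ?F q)) (closed_subspace_gen (\<Union>q\<in>?L2. ?F q))"
    by (rule mp) (use m in auto)
  moreover have "P n (Suc m) e \<in> closed_subspace_gen (\<Union>q\<in>?L1. ?F q)"
  proof -
    have "P n (Suc m) e \<in> ?F (n, Suc m)" unfolding closed_subspace_gen_def by (auto intro!: hull_inc)
    then have "P n (Suc m) e \<in> (\<Union>q\<in>?L1. ?F q)" by blast
    then show ?thesis unfolding closed_subspace_gen_def by (rule hull_inc)
  qed
  moreover have "exactly (P n) m i e \<in> closed_subspace_gen (\<Union>q\<in>?L2. ?F q)"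
  proof -
    have "exactly (P n) m i e \<in> G" if G: "riesz_subspace G" "(\<Union>q\<in>?L2. ?F q) \<subseteq> G" for G
    proof (rule exactly_in_riesz_subspace[OF op G(1) _ e])
      have gen: "P n k e \<in> G \<and> e \<in> G" if k: "1 \<le> k" "k \<le> m" for k
      proof -
        have "P n k e \<in> ?F (n, k)" unfolding closed_subspace_gen_def by (auto intro!: hull_inc)
        moreover have "e \<in> ?F (n, k)"
          unfolding closed_subspace_gen_def using T(2) by (intro hull_inc UnI2) (metis rangeI)
        ultimately show ?thesis using G(2) k by blast
      qed
      then show "P n k e \<in> G" if "1 \<le> k" "k \<le> m" for k using that by blast
      show "e \<in> G" using gen[of m] False by simp
    qed (use m in auto)
    then show ?thesis unfolding closed_subspace_gen_def hull_def by blast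
  qed
  moreover have "band_projection (exactly (P n) m i)"
    using op m by (intro band_projection_if_order_projection order_projection_exactly) auto
  ultimately have "indep_projections T e (P n (Suc m)) (exactly (P n) m i)"
    unfolding indep_subspaces_def using P[of "Suc m"] m by auto
  then show ?thesis unfolding indep_projections_def by simp
qed

theorem theorem5p6:
  fixes T :: "'a::riesz_space \<Rightarrow> 'a" and e :: 'a
    and \<iota> :: "'a \<Rightarrow> 'u::f_algebra"
    and P :: "nat \<Rightarrow> nat \<Rightarrow> 'a \<Rightarrow> 'a" and gs S :: "nat \<Rightarrow> 'a" and g :: 'a and j :: nat
  assumes "dedekind_complete (UNIV :: 'a set)"
    and "weak_order_unit e" and "T e = e"
    and "conditional_expectation T" and "strictly_positive T"
    and "universal_completion \<iota>" and "natural_multiplication \<iota> e"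
    and "T_universally_complete \<iota> T"
    and "\<And>n k. 1 \<le> k \<Longrightarrow> k \<le> n \<Longrightarrow> band_projection (P n k)"
    and "indep_projection_family T e {(n, k). 1 \<le> k \<and> k \<le> n} (\<lambda>(n, k). P n k)"
    and "\<And>n k. 1 \<le> k \<Longrightarrow> k \<le> n \<Longrightarrow> T (P n k e) = gs n"
    and "\<And>n. S n = (\<Sum>k=1..n. P n k e)"
    and "indep_elements T e {1..} S"
    and "\<And>n. 1 \<le> n \<Longrightarrow> T (S n) = g"
  shows "\<exists>h. \<iota> h = (1 / fact j) *\<^sub>R (\<iota> g ^ j * apply_cont (\<lambda>t. exp (- t)) (\<iota> g)) \<and>
    e_uniform_conv e (\<lambda>n. T (proj_eq (S n) (real j *\<^sub>R e) e)) h"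
proof -
  have DC: "dedekind_complete (UNIV :: 'u set)" and \<iota>: "linear \<iota>" "inj \<iota>"
    and \<iota>sup: "\<iota> (sup x y) = sup (\<iota> x) (\<iota> y)" and \<iota>inf: "\<iota> (inf x y) = inf (\<iota> x) (\<iota> y)" for x y
    using assms(6) unfolding universal_completion_def by auto
  have A: "archimedean TYPE('u)" by (rule archimedean_if_dedekind_complete[OF DC])
  have \<iota>e: "\<iota> e = 1" using assms(7) unfolding natural_multiplication_def by blast
  have e: "0 \<le> e" using assms(2) unfolding weak_order_unit_def by blast
  have T: "linear T" "\<And>x. T (T x) = T x" "\<And>x. 0 \<le> x \<Longrightarrow> 0 \<le> T x" "riesz_subspace (range T)" "T e = e"
    using assms(3,4) unfolding conditional_expectation_def by auto
  have Tmono: "T x \<le> T y" if "x \<le> y" for x y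
    using T(3)[of "y - x"] that by (simp add: linear_diff[OF T(1)])
  note \<iota>lin = linear_add[OF \<iota>(1)] linear_diff[OF \<iota>(1)] linear_scale[OF \<iota>(1)] linear_0[OF \<iota>(1)]
  have \<iota>le: "\<iota> x \<le> \<iota> y \<longleftrightarrow> x \<le> y" for x y
    using \<iota>inf[of x y] \<iota>(2) by (metis inf.absorb_iff1 injD)
  have \<iota>abs: "\<iota> \<bar>x\<bar> = \<bar>\<iota> x\<bar>" for x
    using \<iota>lin(2)[of 0 x] by (simp add: abs_lattice \<iota>sup \<iota>lin(4))
  have P: "order_projection (P n k)" if "1 \<le> k" "k \<le> n" for n k
    using assms(9)[OF that] by (rule order_projection_if_band_projection)
  have gs: "gs n = (1 / real n) *\<^sub>R g" if "1 \<le> n" for n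
  proof -
    have "g = (\<Sum>k=1..n. T (P n k e))"
      using assms(14)[OF that] by (simp add: assms(12) linear_sum[OF T(1)])
    also have "\<dots> = (\<Sum>k=1..n. gs n)" using assms(11) by (intro sum.cong) auto
    also have "\<dots> = real n *\<^sub>R gs n" by (simp add: sum_constant_scaleR)
    finally show ?thesis using that by simp
  qed
  have g: "g = T (P 1 1 e)" using gs[of 1] assms(11)[of 1 1] by simp
  have "0 \<le> g" "g \<le> e"
    using order_projectionD(3,4)[OF P[of 1 1] e] T(3) Tmono[of "P 1 1 e" e] T(5) by (auto simp: g)
  define x where "x = \<iota> g"
  have x: "0 \<le> x" "x \<le> 1"
    using \<open>0 \<le> g\<close> \<open>g \<le> e\<close> \<iota>le[of 0 g] \<iota>le[of g e] by (simp_all add: x_def \<iota>e \<iota>lin(4))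
  define \<Phi> where "\<Phi> = unit_calculus x"
  have \<Phi>: "functional_calculus 0 1 x \<Phi>" unfolding \<Phi>_def by (rule functional_calculus_unit_calculus[OF DC x])
  note \<Phi>D = functional_calculusD[OF \<Phi>]
  have \<Phi>0: "\<Phi> (\<lambda>t. 0) = 0" using \<Phi>D(3)[OF continuous_on_const, of 0 1] by simp

  \<comment> \<open>the terms of the sequence and the image in \<open>E\<^sup>u\<close> of the prospective limit\<close>
  define t where "t n = T (proj_eq (S n) (real j *\<^sub>R e) e)" for n
  define L where "L = \<Phi> (\<lambda>t. t ^ j * exp (- t) / fact j)"
  have L: "L = (1 / fact j) *\<^sub>R (x ^ j * apply_cont (\<lambda>t. exp (- t)) x)"
  proof -
    have "\<Phi> (\<lambda>t. (1 / fact j) * (t ^ j * exp (- t))) = (1 / fact j) *\<^sub>R \<Phi> (\<lambda>t. t ^ j * exp (- t))"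
      by (intro \<Phi>D(3) continuous_intros)
    moreover have "\<Phi> (\<lambda>t. t ^ j * exp (- t)) = \<Phi> (\<lambda>t. t ^ j) * \<Phi> (\<lambda>t. exp (- t))"
      by (intro \<Phi>D(5) continuous_intros)
    moreover have "apply_cont (\<lambda>t. exp (- t)) x = \<Phi> (\<lambda>t. exp (- t))"
      by (intro apply_cont_eq[OF A \<Phi>] continuous_intros)
    ultimately show ?thesis by (simp add: L_def functional_calculus_power[OF \<Phi>])
  qed
  have cb: "continuous_on I (\<lambda>t. binomial_prob m i (t / real n))" for I m i n
    unfolding binomial_prob_def divide_inverse by (intro continuous_intros)
  \<comment> \<open>the recursion for \<open>exactly\<close> is carried over to the binomial probabilities at \<open>g/n\<close>\<close>
  have distribution: "\<iota> (T (exactly (P n) m i e)) = \<Phi> (\<lambda>t. binomial_prob m i (t / real n))"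
    if "m \<le> n" "1 \<le> n" for n m i
    using that(1)
  proof (induction m arbitrary: i)
    case 0
    show ?case
      using \<Phi>D(1) \<Phi>0 T(5) by (simp add: binomial_prob_0 \<iota>e \<iota>lin(4) linear_0[OF T(1)])
  next
    case (Suc m)
    let ?R = "P n (Suc m)" and ?Q = "exactly (P n) m" and ?b = "\<lambda>i t. binomial_prob m i (t / real n)"
    have R: "order_projection ?R" using P Suc.prems by simp
    have Q: "order_projection (?Q l)" for l using P Suc.prems by (intro order_projection_exactly) auto
    have IH: "\<iota> (T (?Q l e)) = \<Phi> (?b l)" for l using Suc by simp
    have "\<Phi> (\<lambda>t. (1 / real n) * t) = (1 / real n) *\<^sub>R x"
      using \<Phi>D(3)[OF continuous_on_id, of "1 / real n"] \<Phi>D(2) by simp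
    then have p: "\<iota> (T (?R e)) = \<Phi> (\<lambda>t. t / real n)"
      using assms(11)[of "Suc m" n] gs[OF that(2)] Suc.prems by (simp add: \<iota>lin(3) x_def)
    have hit: "\<iota> (T (?R (?Q l e))) = \<Phi> (\<lambda>t. t / real n * ?b l t)" for l
    proof -
      have "\<iota> (T (?R (?Q l e))) = \<iota> (T (?R (T (?Q l e))))"
        using indep_projection_step[OF assms(10,9) T(1,5) e Suc.prems] by simp
      also have "\<dots> = \<iota> (T (?R e)) * \<iota> (T (?Q l e))"
        using order_projectionD(3,4)[OF Q e, of l] T(3,5) Tmono[of "?Q l e" e]
        by (intro conditional_expectation_averaging[OF A \<iota>(1) \<iota>inf \<iota>e T R e]) auto
      also have "\<dots> = \<Phi> (\<lambda>t. t / real n * ?b l t)"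
        unfolding p IH by (intro \<Phi>D(5)[symmetric] cb continuous_intros) (use that(2) in auto)
      finally show ?thesis .
    qed
    have hit': "\<iota> (T (?R (if i = 0 then 0 else ?Q (i - 1) e))) =
        \<Phi> (\<lambda>t. t / real n * (if i = 0 then 0 else ?b (i - 1) t))"
      using hit[of "i - 1"] order_projectionD(8)[OF R] \<Phi>0 by (simp add: \<iota>lin(4) linear_0[OF T(1)])
    have cont: "continuous_on {0..1} (\<lambda>t. t / real n * ?b l t)"
      "continuous_on {0..1} (\<lambda>t. t / real n * (if i = 0 then 0 else ?b (i - 1) t))" for l
      using that(2) by (cases "i = 0"; intro continuous_intros cb; simp)+
    have "\<iota> (T (exactly (P n) (Suc m) i e)) =
        \<Phi> (\<lambda>t. t / real n * (if i = 0 then 0 else ?b (i - 1) t)) +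
        (\<Phi> (?b i) - \<Phi> (\<lambda>t. t / real n * ?b i t))"
      by (simp only: exactly.simps linear_add[OF T(1)] linear_diff[OF T(1)] \<iota>lin hit hit' IH)
    also have "\<dots> = \<Phi> (\<lambda>t. t / real n * (if i = 0 then 0 else ?b (i - 1) t) + (?b i t - t / real n * ?b i t))"
      by (simp only: \<Phi>D(4) \<Phi>D(6) cont cb continuous_on_diff)
    finally show ?case by (simp only: binomial_prob_Suc)
  qed
  have close: "\<exists>N. \<forall>n\<ge>N. \<bar>\<iota> (t n) - L\<bar> \<le> \<epsilon> *\<^sub>R 1" if \<epsilon>: "0 < \<epsilon>" for \<epsilon>
  proof -
    obtain N where N: "1 \<le> N" "\<And>n s. N \<le> n \<Longrightarrow> s \<in> {0..1} \<Longrightarrow>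
        \<bar>binomial_prob n j (s / real n) - s ^ j * exp (- s) / fact j\<bar> \<le> \<epsilon>"
      using poisson_limit_theorem_uniform[OF \<epsilon>, of j] by blast
    have "\<bar>\<iota> (t n) - L\<bar> \<le> \<epsilon> *\<^sub>R 1" if n: "N \<le> n" for n
    proof -
      have n1: "1 \<le> n" using N(1) n by simp
      have "\<iota> (t n) = \<Phi> (\<lambda>t. binomial_prob n j (t / real n))"
        using distribution[OF order_refl n1] proj_eq_sum_projections[OF P e]
        by (simp add: t_def assms(12))
      then have "\<iota> (t n) - L = \<Phi> (\<lambda>s. binomial_prob n j (s / real n) - s ^ j * exp (- s) / fact j)"
        unfolding L_def by (subst \<Phi>D(6)) (auto intro!: continuous_intros cb)
      also have "\<bar>\<dots>\<bar> \<le> \<epsilon> *\<^sub>R 1"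
        by (rule functional_calculus_bound[OF \<Phi> _ N(2)[OF n]]) (auto intro!: continuous_intros cb)
      finally show ?thesis .
    qed
    then show ?thesis by blast
  qed
  then have conv: "e_uniform_conv 1 (\<lambda>n. \<iota> (t n)) L" unfolding e_uniform_conv_def by blast
  \<comment> \<open>\<open>L\<close> lies in the image of \<open>E\<close>: the sequence is Cauchy already in \<open>E\<close>, which is uniformly complete\<close>
  have "\<exists>h. e_uniform_conv e t h"
  proof (rule e_uniform_conv_if_Cauchy[OF assms(1) e])
    fix \<epsilon> :: real assume "0 < \<epsilon>"
    then obtain N where N: "\<And>n. N \<le> n \<Longrightarrow> \<bar>\<iota> (t n) - L\<bar> \<le> (\<epsilon> / 2) *\<^sub>R 1" using close[of "\<epsilon> / 2"] by auto
    have "\<bar>t n - t m\<bar> \<le> \<epsilon> *\<^sub>R e" if "N \<le> n" "N \<le> m" for n m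
    proof -
      have "\<bar>\<iota> (t n) - \<iota> (t m)\<bar> \<le> \<bar>\<iota> (t n) - L\<bar> + \<bar>\<iota> (t m) - L\<bar>"
        using abs_triangle_ineq4[of "\<iota> (t n) - L" "\<iota> (t m) - L"] by simp
      also have "\<dots> \<le> (\<epsilon> / 2) *\<^sub>R 1 + (\<epsilon> / 2) *\<^sub>R 1" using N that by (intro add_mono) auto
      also have "\<dots> = \<iota> (\<epsilon> *\<^sub>R e)" by (simp add: \<iota>lin(3) \<iota>e flip: scaleR_add_left)
      finally have "\<iota> \<bar>t n - t m\<bar> \<le> \<iota> (\<epsilon> *\<^sub>R e)" by (simp add: \<iota>abs \<iota>lin(2))
      then show ?thesis by (simp only: \<iota>le)
    qed
    then show "\<exists>N. \<forall>n\<ge>N. \<forall>m\<ge>N. \<bar>t n - t m\<bar> \<le> \<epsilon> *\<^sub>R e" by blast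
  qed
  then obtain h where h: "e_uniform_conv e t h" by blast
  have "e_uniform_conv 1 (\<lambda>n. \<iota> (t n)) (\<iota> h)"
    unfolding e_uniform_conv_def
  proof (intro allI impI)
    fix \<epsilon> :: real assume "0 < \<epsilon>"
    then obtain N where N: "\<And>n. N \<le> n \<Longrightarrow> \<bar>t n - h\<bar> \<le> \<epsilon> *\<^sub>R e" using e_uniform_convD[OF h] by blast
    have "\<bar>\<iota> (t n) - \<iota> h\<bar> \<le> \<epsilon> *\<^sub>R 1" if "N \<le> n" for n
      using N[OF that] \<iota>le[of "\<bar>t n - h\<bar>" "\<epsilon> *\<^sub>R e"] by (simp add: \<iota>abs \<iota>lin(2,3) \<iota>e)
    then show "\<exists>N. \<forall>n\<ge>N. \<bar>\<iota> (t n) - \<iota> h\<bar> \<le> \<epsilon> *\<^sub>R 1" by blast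
  qed
  from e_uniform_conv_unique[OF A this conv] have "\<iota> h = L" .
  then show ?thesis using h unfolding L x_def t_def by blast
qed

end
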